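(* Let $\Delta=(w,\lambda)$ be a complete simplicial multi-fan in $V$ on $[m]$, and let $v\in V$ be a generic vector, i.e. for every $n$-subset $I$ with $w(I)\ne0$, every $n$ vectors among $\{\lambda(i)\}_{i\in I}\cup\{v\}$ are linearly independent. Then $$V_\Delta(c_1,\dots,c_m)=\frac1{n!}\sum_{I=\{i_1,\dots,i_n\}\in K}\frac{w(I)}{|\det\lambda_I|\prod_{j=1}^n\alpha_{I,j}}\big(\alpha_{I,1}c_{i_1}+\dots+\alpha_{I,n}c_{i_n}\big)^n,$$ where $\alpha_{I,1},\dots,\alpha_{I,n}$ are the coordinates of $v$ in the basis $(\lambda(i_1),\dots,\lambda(i_n))$.
   Context: Let $V$ be an oriented real vector space of dimension $n\ge1$ with an inner product; identify $V^*=V$; $|\det\lambda_I|$ is the volume of the parallelepiped spanned by $\{\lambda(i)\}_{i\in I}$. A complete simplicial multi-fan $\Delta=(w,\lambda)$ on $[m]$: $w\colon\binom{[m]}n\to\mathbb R$, $\lambda\colon[m]\to V$, with $\{\lambda(i)\}_{i\in I}$ a basis whenever $w(I)\ne0$, and, orienting each such $I$ so that $(i_1,\dots,i_n)$ is positive iff $(\lambda(i_1),\dots,\lambda(i_n))$ is a positive basis, $\sum_Iw(I)I$ is a cycle in the real chain complex of the $(n-1)$-skeleton of the simplex on $[m]$ (augmentation if $n=1$). $K$ is the simplicial complex of all subsets of the $I$ with $w(I)\ne0$. Volume polynomial: with $\deg x_i=2$, for $w(I)\ne0$ let $\{u^I_i\}$ be the basis of $V^*$ dual to $\{\lambda(i)\}_{i\in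 I}$ and $\iota_I\colon\mathbb R[x_1,\dots,x_m]\to\mathbb R[V^*]$ the homomorphism with $\iota_I(x_i)=u^I_i$ for $i\in I$, $0$ otherwise. For $x$ homogeneous of degree $2n$, $\int_\Delta x=\sum_I\frac{w(I)\iota_I(x)}{|\det\lambda_I|\prod_{i\in I}\iota_I(x_i)}$ is a constant, and $V_\Delta(c)=\frac1{n!}\int_\Delta(c_1x_1+\dots+c_mx_m)^n$. *)

theory Defs
  imports
    "Jordan_Normal_Form.Determinant"
    "HOL-Analysis.Analysis"
    "HOL-Library.Poly_Mapping"
    "HOL-Computational_Algebra.Fraction_Field"
begin

section \<open>Orientations of a Euclidean space\<close>

text \<open>The list is read as a family of vectors: a repeated vector makes it dependent.\<close>

definition lin_indep_family :: "'a::real_vector list \<Rightarrow> bool" where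
  "lin_indep_family vs \<longleftrightarrow> distinct vs \<and> independent (set vs)"

definition ordered_basis :: "'a::real_vector list \<Rightarrow> bool" where
  "ordered_basis vs \<longleftrightarrow> lin_indep_family vs \<and> span (set vs) = UNIV"

text \<open>Column \<open>j\<close> consists of the coordinates of the \<open>j\<close>-th vector of \<open>vs\<close> in the basis \<open>bs\<close>.\<close>

definition transition_mat :: "'a::euclidean_space list \<Rightarrow> 'a list \<Rightarrow> real mat" where
  "transition_mat bs vs =
     Matrix.mat DIM('a) DIM('a) (\<lambda>(i, j). representation (set bs) (vs ! j) (bs ! i))"

definition same_orientation :: "('a::euclidean_space list \<times> 'a list) set" where
  "same_orientation = {(bs, vs). ordered_basis bs \<and> ordered_basis vs \<and>
     Determinant.det (transition_mat bs vs) > 0}"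

text \<open>An orientation is an equivalence class of ordered bases; its members are the positive bases.\<close>

definition orientations :: "'a::euclidean_space list set set" where
  "orientations = {bs. ordered_basis bs} // same_orientation"


section \<open>Complete simplicial multi-fans\<close>

definition subsets_of_size :: "nat \<Rightarrow> nat \<Rightarrow> nat set set" where
  "subsets_of_size m k = {I. I \<subseteq> {1..m} \<and> card I = k}"

definition listed :: "(nat \<Rightarrow> 'a) \<Rightarrow> nat set \<Rightarrow> 'a list" where
  "listed lam I = map lam (sorted_list_of_set I)"

text \<open>A \<open>k\<close>-subset of \<open>{1..m}\<close> stands for the simplex oriented by the increasing order of its
  vertices, and a chain is given by its coefficients in these generators. Since the empty set is
  admitted as a face, the boundary of a vertex is the augmentation.\<close>

definition simplex_boundary :: "nat set \<Rightarrow> nat set \<Rightarrow> real" where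
  "simplex_boundary I J = (\<Sum>i\<in>I. if J = I - {i} then (-1) ^ card {j \<in> I. j < i} else 0)"

definition is_cycle :: "nat \<Rightarrow> nat \<Rightarrow> (nat set \<Rightarrow> real) \<Rightarrow> bool" where
  "is_cycle m k z \<longleftrightarrow> (\<forall>J. (\<Sum>I\<in>subsets_of_size m k. z I * simplex_boundary I J) = 0)"

text \<open>Coefficient of the increasingly ordered simplex in the simplex \<open>I\<close> oriented by \<open>lam\<close>.\<close>

definition orientation_sign :: "'a::euclidean_space list set \<Rightarrow> (nat \<Rightarrow> 'a) \<Rightarrow> nat set \<Rightarrow> real" where
  "orientation_sign ori lam I = (if listed lam I \<in> ori then 1 else -1)"

text \<open>Only the values of \<open>w\<close> on the \<open>n\<close>-subsets of \<open>{1..m}\<close>, where \<open>n = DIM('a)\<close>, and those of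
  \<open>lam\<close> on \<open>{1..m}\<close> are relevant.\<close>

definition complete_simplicial_multifan ::
  "'a::euclidean_space list set \<Rightarrow> nat \<Rightarrow> (nat set \<Rightarrow> real) \<Rightarrow> (nat \<Rightarrow> 'a) \<Rightarrow> bool" where
  "complete_simplicial_multifan ori m w lam \<longleftrightarrow>
     (\<forall>I\<in>subsets_of_size m DIM('a). w I \<noteq> 0 \<longrightarrow> ordered_basis (listed lam I)) \<and>
     is_cycle m DIM('a) (\<lambda>I. w I * orientation_sign ori lam I)"

definition multifan_complex :: "nat \<Rightarrow> (nat set \<Rightarrow> real) \<Rightarrow> (nat \<Rightarrow> 'a::euclidean_space) \<Rightarrow> nat set set"
  where
  "multifan_complex m w lam = {J. \<exists>I\<in>subsets_of_size m DIM('a). w I \<noteq> 0 \<and> J \<subseteq> I}"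

text \<open>The \<open>n + 1\<close> vectors \<open>v\<close> and \<open>lam i\<close> for \<open>i \<in> I\<close> form a family, so \<open>v\<close> cannot coincide
  with one of the others when \<open>n \<ge> 2\<close>.\<close>

definition generic_vector ::
  "nat \<Rightarrow> (nat set \<Rightarrow> real) \<Rightarrow> (nat \<Rightarrow> 'a::euclidean_space) \<Rightarrow> 'a \<Rightarrow> bool" where
  "generic_vector m w lam v \<longleftrightarrow>
     (\<forall>I\<in>subsets_of_size m DIM('a). w I \<noteq> 0 \<longrightarrow>
        (\<forall>vs\<in>set (subseqs (v # listed lam I)). length vs = DIM('a) \<longrightarrow> lin_indep_family vs))"


section \<open>The ring of polynomial functions\<close>

typedef (overloaded) 'a polyfun = "{f :: 'a::euclidean_space \<Rightarrow> real. real_polynomial_function f}"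
  morphisms apply_polyfun Polyfun
  by (rule exI[of _ "\<lambda>_. 0"]) auto

setup_lifting type_definition_polyfun

instantiation polyfun :: (euclidean_space) comm_ring_1
begin

lift_definition zero_polyfun :: "'a polyfun" is "\<lambda>_. 0" by (rule real_polynomial_function.intros(2))
lift_definition one_polyfun :: "'a polyfun" is "\<lambda>_. 1" by (rule real_polynomial_function.intros(2))
lift_definition plus_polyfun :: "'a polyfun \<Rightarrow> 'a polyfun \<Rightarrow> 'a polyfun"
  is "\<lambda>f g v. f v + g v" by (rule real_polynomial_function.intros(3))
lift_definition times_polyfun :: "'a polyfun \<Rightarrow> 'a polyfun \<Rightarrow> 'a polyfun"
  is "\<lambda>f g v. f v * g v" by (rule real_polynomial_function.intros(4))
lift_definition uminus_polyfun :: "'a polyfun \<Rightarrow> 'a polyfun"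
  is "\<lambda>f v. - f v" by (rule real_polynomial_function_minus)
lift_definition minus_polyfun :: "'a polyfun \<Rightarrow> 'a polyfun \<Rightarrow> 'a polyfun"
  is "\<lambda>f g v. f v - g v" by (rule real_polynomial_function_diff)

instance
proof
  show "(0 :: 'a polyfun) \<noteq> 1" by transfer (simp add: fun_eq_iff)
qed (transfer; simp add: algebra_simps)+

end

lemma real_polynomial_function_on_line:
  fixes f :: "'a::euclidean_space \<Rightarrow> real"
  assumes "real_polynomial_function f"
  shows "\<exists>p. \<forall>t. f (a + t *\<^sub>R d) = poly p t"
  using assms
proof induction
  case (linear f)
  then have "f (a + t *\<^sub>R d) = poly [:f a, f d:] t" for t
    by (simp add: bounded_linear.linear linear_add linear_scale)
  then show ?case by blast
next
  case (const c)
  have "c = poly [:c:] t" for t by simp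
  then show ?case by blast
next
  case (add f g)
  then show ?case by (metis poly_add)
next
  case (mult f g)
  then show ?case by (metis poly_mult)
qed

instance polyfun :: (euclidean_space) idom
proof
  fix f g :: "'a polyfun"
  assume "f \<noteq> 0" "g \<noteq> 0"
  then show "f * g \<noteq> 0"
  proof transfer
    fix f g :: "'a \<Rightarrow> real"
    assume fg: "real_polynomial_function f" "real_polynomial_function g"
      and "f \<noteq> (\<lambda>_. 0)" "g \<noteq> (\<lambda>_. 0)"
    then obtain a b where ab: "f a \<noteq> 0" "g b \<noteq> 0" by (auto simp: fun_eq_iff)
    obtain p where p: "\<And>t. f (a + t *\<^sub>R (b - a)) = poly p t"
      using real_polynomial_function_on_line[OF fg(1)] by metis
    obtain q where q: "\<And>t. g (a + t *\<^sub>R (b - a)) = poly q t"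
      using real_polynomial_function_on_line[OF fg(2)] by metis
    have "poly p 0 \<noteq> 0" "poly q 1 \<noteq> 0"
      using ab p[of 0] q[of 1] by simp_all
    then have "p * q \<noteq> 0" by auto
    then obtain t where "poly (p * q) t \<noteq> 0"
      using poly_all_0_iff_0 by blast
    then have "f (a + t *\<^sub>R (b - a)) * g (a + t *\<^sub>R (b - a)) \<noteq> 0"
      by (simp add: p q)
    then show "(\<lambda>v. f v * g v) \<noteq> (\<lambda>_. 0)" by metis
  qed
qed

lift_definition const_polyfun :: "real \<Rightarrow> 'a::euclidean_space polyfun" is "\<lambda>r _. r"
  by (rule real_polynomial_function.intros(2))


section \<open>The volume polynomial\<close>

text \<open>\<open>\<real>[x\<^sub>1, x\<^sub>2, \<dots>]\<close>: an exponent vector is a finitely supported map on the indices of the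
  variables, and a polynomial is a finitely supported map on the exponent vectors.\<close>

type_synonym rpoly = "(nat \<Rightarrow>\<^sub>0 nat) \<Rightarrow>\<^sub>0 real"

definition poly_const :: "real \<Rightarrow> rpoly" where
  "poly_const r = Poly_Mapping.single 0 r"

definition poly_var :: "nat \<Rightarrow> rpoly" where
  "poly_var i = Poly_Mapping.single (Poly_Mapping.single i 1) 1"

definition substitute :: "(nat \<Rightarrow> 'a::euclidean_space polyfun) \<Rightarrow> rpoly \<Rightarrow> 'a polyfun" where
  "substitute s p = (\<Sum>e\<in>Poly_Mapping.keys p. const_polyfun (Poly_Mapping.lookup p e) *
     (\<Prod>i\<in>Poly_Mapping.keys e. s i ^ Poly_Mapping.lookup e i))"

definition dual_basis_vector :: "(nat \<Rightarrow> 'a::euclidean_space) \<Rightarrow> nat set \<Rightarrow> nat \<Rightarrow> 'a \<Rightarrow> real" where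
  "dual_basis_vector lam I i =
     (THE u. linear u \<and> (\<forall>j\<in>I. u (lam j) = (if j = i then 1 else 0)))"

definition iota :: "(nat \<Rightarrow> 'a::euclidean_space) \<Rightarrow> nat set \<Rightarrow> rpoly \<Rightarrow> 'a polyfun" where
  "iota lam I = substitute (\<lambda>i. if i \<in> I then Polyfun (dual_basis_vector lam I i) else 0)"

definition parallelepiped :: "(nat \<Rightarrow> 'a::euclidean_space) \<Rightarrow> nat set \<Rightarrow> 'a set" where
  "parallelepiped lam I = {(\<Sum>i\<in>I. t i *\<^sub>R lam i) | t. \<forall>i\<in>I. 0 \<le> t i \<and> t i \<le> 1}"

text \<open>\<open>\<bar>det \<lambda>\<^sub>I\<bar>\<close>.\<close>

definition abs_det :: "(nat \<Rightarrow> 'a::euclidean_space) \<Rightarrow> nat set \<Rightarrow> real" where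
  "abs_det lam I = measure lebesgue (parallelepiped lam I)"

definition multifan_sum ::
  "nat \<Rightarrow> (nat set \<Rightarrow> real) \<Rightarrow> (nat \<Rightarrow> 'a::euclidean_space) \<Rightarrow> rpoly \<Rightarrow> 'a polyfun fract" where
  "multifan_sum m w lam x =
     (\<Sum>I | I \<in> subsets_of_size m DIM('a) \<and> w I \<noteq> 0.
        Fract (const_polyfun (w I) * iota lam I x)
              (const_polyfun (abs_det lam I) * (\<Prod>i\<in>I. iota lam I (poly_var i))))"

text \<open>Meaningful for \<open>x\<close> homogeneous of degree \<open>2n\<close>, where each variable has degree 2: the sum is
  then a constant rational function, and the integral is its value.\<close>

definition multifan_integral ::
  "nat \<Rightarrow> (nat set \<Rightarrow> real) \<Rightarrow> (nat \<Rightarrow> 'a::euclidean_space) \<Rightarrow> rpoly \<Rightarrow> real" where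
  "multifan_integral m w lam x = (THE r. multifan_sum m w lam x = Fract (const_polyfun r) 1)"

definition volume_polynomial ::
  "nat \<Rightarrow> (nat set \<Rightarrow> real) \<Rightarrow> (nat \<Rightarrow> 'a::euclidean_space) \<Rightarrow> (nat \<Rightarrow> real) \<Rightarrow> real" where
  "volume_polynomial m w lam c =
     1 / fact DIM('a) * multifan_integral m w lam ((\<Sum>i=1..m. poly_const (c i) * poly_var i) ^ DIM('a))"

end

theory Submission
  imports Defs
begin

text \<open>
  Let \<open>S(u)\<close> be the value at \<open>u\<close> of the rational function whose constant value defines the integral
  of \<open>(\<Sum>i. c i x i)\<^sup>n\<close>; the claim is that \<open>S\<close> is constant, for then \<open>S(v)\<close> is the right-hand side.
  The coordinates of a vector in the basis \<open>\<lambda>\<^sub>I\<close> are the values of the dual basis. For a fixed \<open>v\<close> and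
  \<open>u\<close> outside a proper algebraic subset, the summand \<open>F\<^sub>I(u)\<close> is expanded into partial fractions along
  the line \<open>t \<mapsto> u - t v\<close>: evaluated at \<open>t = 0\<close>, the constant term is \<open>F\<^sub>I(v)\<close> and the pole where the
  line meets the hyperplane spanned by \<open>\<lambda>\<^sub>J\<close>, with \<open>J = I - {j}\<close>, contributes, up to the sign of \<open>J\<close>
  in the boundary of \<open>I\<close>, a quantity \<open>H\<^sub>J\<close> that does not depend on \<open>I\<close>. These contributions cancel in
  the sum over \<open>I\<close> because the weights form a cycle. Hence \<open>S(u) = S(v)\<close> generically, and therefore as
  rational functions.
\<close>

section \<open>Partial fractions\<close>

text \<open>The sum is the divided difference of \<open>p\<close> over the nodes \<open>A\<close>.
  The Lagrange interpolant \<open>q\<close> has degree at most \<open>n\<close> and agrees with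
  \<open>p\<close> at \<open>n + 1\<close> points, hence equals \<open>p\<close>. Each
  \<open>L a\<close> is monic of degree \<open>n\<close>, so the coefficient of \<open>q\<close> at
  \<open>n\<close> is the sum of its weights.\<close>

lemma sum_lagrange_leading_coeff:
  fixes p :: "'a::field poly"
  assumes A: "finite A" "card A = Suc n" and p: "degree p \<le> n"
  shows "(\<Sum>a\<in>A. poly p a / (\<Prod>b\<in>A - {a}. a - b)) = coeff p n"
proof -
  define L where "L a = (\<Prod>b\<in>A - {a}. [:- b, 1:])" for a
  define q where "q = (\<Sum>a\<in>A. smult (poly p a / (\<Prod>b\<in>A - {a}. a - b)) (L a))"
  have deg: "degree (L a) = n" if "a \<in> A" for a
    unfolding L_def using that A by (subst degree_prod_eq_sum_degree) auto
  have lead: "coeff (L a) n = 1" if "a \<in> A" for a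
    using lead_coeff_prod[of "\<lambda>b. [:- b, 1:]" "A - {a}"] deg[OF that] by (simp add: L_def)
  have "poly q x = poly p x" if x: "x \<in> A" for x
  proof -
    have "poly (L a) x = 0" if "a \<in> A" "a \<noteq> x" for a
      using that x A by (auto simp: L_def poly_prod)
    then have "poly q x = poly p x / (\<Prod>b\<in>A - {x}. x - b) * poly (L x) x"
      unfolding q_def poly_sum poly_smult
      by (subst sum.remove[OF A(1) x]) (auto intro!: sum.neutral)
    moreover have "(\<Prod>b\<in>A - {x}. x - b) \<noteq> 0" using A by simp
    ultimately show ?thesis by (simp add: L_def poly_prod)
  qed
  moreover have "degree q \<le> n"
    unfolding q_def by (intro degree_sum_le[OF A(1)]) (metis deg degree_smult_le)
  ultimately have "p = q" using A p by (intro poly_eqI_degree[of A]) auto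
  then have "coeff p n = coeff q n" by simp
  then show ?thesis by (simp add: q_def coeff_sum lead)
qed

text \<open>Lagrange interpolation of \<open>(X - t Y)\<^sup>n\<close> at \<open>0\<close> and at the \<open>n\<close> ratios \<open>t = x j / y j\<close>.\<close>

lemma power_div_prod_exchange:
  fixes x y :: "'i \<Rightarrow> 'a::field"
  assumes I: "finite I" and x: "\<And>i. i \<in> I \<Longrightarrow> x i \<noteq> 0" and y: "\<And>i. i \<in> I \<Longrightarrow> y i \<noteq> 0"
    and xy: "\<And>i j. i \<in> I \<Longrightarrow> j \<in> I \<Longrightarrow> i \<noteq> j \<Longrightarrow> x i * y j \<noteq> x j * y i"
  shows "X ^ card I / (\<Prod>i\<in>I. x i) = Y ^ card I / (\<Prod>i\<in>I. y i)
    + (\<Sum>j\<in>I. (X - x j / y j * Y) ^ card I / (x j * (\<Prod>i\<in>I - {j}. x i - x j / y j * y i)))"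
proof -
  define t where "t i = x i / y i" for i
  \<comment> \<open>The node 0 will yield the term in \<open>X\<close>, the node \<open>t j\<close>,
    where \<open>x j - t * y j\<close> vanishes, the \<open>j\<close>-th summand, and the
    coefficient of index \<open>card I\<close> the term in \<open>Y\<close>.\<close>
  define A where "A = insert 0 (t ` I)"
  let ?n = "card I"
  let ?p = "[:X, - Y:] ^ ?n"
  have inj: "inj_on t I"
  proof (rule inj_onI, rule ccontr)
    fix i j assume ij: "i \<in> I" "j \<in> I" "t i = t j" "i \<noteq> j"
    then have "x i * y j = x j * y i"
      using y[of i] y[of j] by (simp add: t_def field_simps)
    with xy ij show False by blast
  qed
  have t0: "t i \<noteq> 0" if "i \<in> I" for i using x[OF that] y[OF that] by (simp add: t_def)
  have t0': "0 \<notin> t ` I" using t0 by auto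
  have A: "finite A" "card A = Suc ?n" using I t0' inj by (simp_all add: A_def card_image)
  have deg: "degree ?p \<le> ?n"
    using degree_power_le[of "[:X, - Y:]" ?n] by (rule order_trans) simp
  \<comment> \<open>This coefficient need not be the leading one: for \<open>Y = 0\<close> the
    degree can drop.\<close>
  have lead: "coeff ?p ?n = (- Y) ^ ?n"
    by (metis coeff_linear_poly_power diff_self_eq_0 binomial_n_n mult_1 of_nat_1 order_refl power_0 mult.right_neutral)
  have nodes: "A - {t j} = insert 0 (t ` (I - {j}))" if "j \<in> I" for j
    using that t0 inj by (auto simp: A_def inj_on_def)
  have prod: "(\<Prod>b\<in>A - {t j}. t j - b) = t j * (\<Prod>i\<in>I - {j}. t j - t i)" if "j \<in> I" for j
    unfolding nodes[OF that] using I t0 inj_on_subset[OF inj, of "I - {j}"]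
    by (subst prod.insert) (auto simp: prod.reindex)
  have prod0: "(\<Prod>b\<in>A - {0}. 0 - b) = (-1) ^ ?n * (\<Prod>i\<in>I. t i)"
  proof -
    have "A - {0} = t ` I" using t0 by (auto simp: A_def)
    then show ?thesis using inj by (simp add: prod.reindex prod_uminus card_image)
  qed
  have "(- Y) ^ ?n = (\<Sum>a\<in>A. poly ?p a / (\<Prod>b\<in>A - {a}. a - b))"
    using sum_lagrange_leading_coeff[OF A deg] lead by simp
  also have "\<dots> = X ^ ?n / ((-1) ^ ?n * (\<Prod>i\<in>I. t i))
      + (\<Sum>j\<in>I. (X - t j * Y) ^ ?n / (t j * (\<Prod>i\<in>I - {j}. t j - t i)))"
    (is "_ = _ + ?S")
  proof -
    have split: "(\<Sum>a\<in>A. f a) = f 0 + (\<Sum>j\<in>I. f (t j))" for f :: "'a \<Rightarrow> 'a"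
      unfolding A_def using I inj t0' by (simp add: sum.reindex)
    show ?thesis unfolding split prod0 by (simp add: prod mult.commute[of Y] cong: sum.cong)
  qed
  finally have lagrange: "(- Y) ^ ?n = X ^ ?n / ((-1) ^ ?n * (\<Prod>i\<in>I. t i)) + ?S" .
  \<comment> \<open>Reversing the \<open>?n - 1\<close> differences costs
    \<open>(-1) ^ (?n - 1)\<close>, which together with the prefactor \<open>(-1) ^ ?n\<close>
    leaves a single minus sign.\<close>
  have flip: "(-1) ^ ?n * (c / (t j * (\<Prod>i\<in>I - {j}. t j - t i)))
      = - (c / (t j * (\<Prod>i\<in>I - {j}. t i - t j)))" if j: "j \<in> I" for j c
  proof -
    obtain k where k: "?n = Suc k" "card (I - {j}) = k"
      using card.remove[OF I j] by metis
    have "(\<Prod>i\<in>I - {j}. t j - t i) = (-1) ^ k * (\<Prod>i\<in>I - {j}. t i - t j)"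
      using prod_uminus[of "\<lambda>i. t i - t j" "I - {j}"] k by simp
    then show ?thesis by (simp add: k(1) divide_simps flip: power_mult_distrib)
  qed
  have "Y ^ ?n = (-1) ^ ?n * (- Y) ^ ?n" by (simp flip: power_mult_distrib)
  also have "\<dots> = X ^ ?n / (\<Prod>i\<in>I. t i)
      - (\<Sum>j\<in>I. (X - t j * Y) ^ ?n / (t j * (\<Prod>i\<in>I - {j}. t i - t j)))"
  proof -
    have "(-1) ^ ?n * ?S =
        - (\<Sum>j\<in>I. (X - t j * Y) ^ ?n / (t j * (\<Prod>i\<in>I - {j}. t i - t j)))"
      unfolding sum_distrib_left sum_negf[symmetric] by (rule sum.cong[OF refl flip])
    then show ?thesis unfolding lagrange distrib_left by simp
  qed
  finally have "X ^ ?n / (\<Prod>i\<in>I. t i) = Y ^ ?n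
      + (\<Sum>j\<in>I. (X - t j * Y) ^ ?n / (t j * (\<Prod>i\<in>I - {j}. t i - t j)))" by simp
  \<comment> \<open>Division by the product of the \<open>y i\<close> gives each difference
    \<open>t i - t j\<close> its own factor \<open>y i\<close>; the remaining factor
    \<open>y j\<close> turns \<open>t j\<close> into \<open>x j\<close>.\<close>
  then have divided: "X ^ ?n / (\<Prod>i\<in>I. t i) / (\<Prod>i\<in>I. y i) = Y ^ ?n / (\<Prod>i\<in>I. y i)
      + (\<Sum>j\<in>I. (X - t j * Y) ^ ?n / (t j * (\<Prod>i\<in>I - {j}. t i - t j)) / (\<Prod>i\<in>I. y i))"
    by (simp add: add_divide_distrib sum_divide_distrib)
  have prod_x: "(\<Prod>i\<in>I. t i) * (\<Prod>i\<in>I. y i) = (\<Prod>i\<in>I. x i)"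
    using y by (simp add: t_def flip: prod.distrib)
  have prod_summand: "t j * (\<Prod>i\<in>I - {j}. t i - t j) * (\<Prod>i\<in>I. y i) =
      x j * (\<Prod>i\<in>I - {j}. x i - t j * y i)" if j: "j \<in> I" for j
  proof -
    have "(\<Prod>i\<in>I. y i) = y j * (\<Prod>i\<in>I - {j}. y i)" using I j by (rule prod.remove)
    moreover have "(\<Prod>i\<in>I - {j}. t i - t j) * (\<Prod>i\<in>I - {j}. y i) = (\<Prod>i\<in>I - {j}. x i - t j * y i)"
      unfolding prod.distrib[symmetric] using y
      by (intro prod.cong) (auto simp: t_def[of i for i] algebra_simps)
    ultimately show ?thesis using y[OF j] by (simp add: t_def[of j])
  qed
  have "(\<Sum>j\<in>I. (X - t j * Y) ^ ?n / (t j * (\<Prod>i\<in>I - {j}. t i - t j)) / (\<Prod>i\<in>I. y i)) =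
      (\<Sum>j\<in>I. (X - t j * Y) ^ ?n / (x j * (\<Prod>i\<in>I - {j}. x i - t j * y i)))"
    by (rule sum.cong[OF refl]) (simp only: divide_divide_eq_left prod_summand)
  with divided show ?thesis by (simp only: divide_divide_eq_left prod_x) (simp only: t_def)
qed

section \<open>Polynomial functions and substitution\<close>

lemma apply_polyfun_simps [simp]:
  "apply_polyfun 0 u = 0" "apply_polyfun 1 u = 1"
  "apply_polyfun (f + g) u = apply_polyfun f u + apply_polyfun g u"
  "apply_polyfun (f - g) u = apply_polyfun f u - apply_polyfun g u"
  "apply_polyfun (f * g) u = apply_polyfun f u * apply_polyfun g u"
  "apply_polyfun (const_polyfun r) u = r"
  by (simp_all add: zero_polyfun.rep_eq one_polyfun.rep_eq plus_polyfun.rep_eq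
      minus_polyfun.rep_eq times_polyfun.rep_eq const_polyfun.rep_eq)

lemma polyfun_eqI: "(\<And>u. apply_polyfun f u = apply_polyfun g u) \<Longrightarrow> f = g"
  by (metis apply_polyfun_inject ext)

lemma apply_polyfun_sum: "apply_polyfun (\<Sum>i\<in>A. f i) u = (\<Sum>i\<in>A. apply_polyfun (f i) u)"
  by (induction A rule: infinite_finite_induct) auto

lemma apply_polyfun_prod: "apply_polyfun (\<Prod>i\<in>A. f i) u = (\<Prod>i\<in>A. apply_polyfun (f i) u)"
  by (induction A rule: infinite_finite_induct) auto

lemma apply_polyfun_power: "apply_polyfun (f ^ k) u = apply_polyfun f u ^ k"
  by (induction k) auto

lemma const_polyfun_simps:
  "const_polyfun 0 = 0" "const_polyfun 1 = 1"
  "const_polyfun (r + s) = const_polyfun r + const_polyfun s"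
  "const_polyfun (r * s) = const_polyfun r * const_polyfun s"
  by (auto intro: polyfun_eqI)

section \<open>Substitution as a ring homomorphism\<close>

lemma substitute_superset:
  assumes "finite A" "Poly_Mapping.keys p \<subseteq> A"
  shows "substitute s p = (\<Sum>e\<in>A. const_polyfun (Poly_Mapping.lookup p e) *
     (\<Prod>i\<in>Poly_Mapping.keys e. s i ^ Poly_Mapping.lookup e i))"
  unfolding substitute_def using assms
  by (intro sum.mono_neutral_left) (auto simp: in_keys_iff const_polyfun_simps)

lemma substitute_add: "substitute s (p + q) = substitute s p + substitute s q"
  using Poly_Mapping.keys_add[of p q]
  by (simp add: substitute_superset[of "Poly_Mapping.keys p \<union> Poly_Mapping.keys q"]
      lookup_add const_polyfun_simps distrib_right sum.distrib)

lemma substitute_0 [simp]: "substitute s 0 = 0"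
  by (simp add: substitute_def)

lemma substitute_sum: "substitute s (\<Sum>i\<in>A. f i) = (\<Sum>i\<in>A. substitute s (f i))"
  by (induction A rule: infinite_finite_induct) (auto simp: substitute_add)

lemma substitute_single:
  "substitute s (Poly_Mapping.single e r) =
     const_polyfun r * (\<Prod>i\<in>Poly_Mapping.keys e. s i ^ Poly_Mapping.lookup e i)"
  by (subst substitute_superset[of "{e}"]) auto

lemma poly_mapping_eq_sum_single:
  "p = (\<Sum>e\<in>Poly_Mapping.keys p. Poly_Mapping.single e (Poly_Mapping.lookup p e))"
  by (rule poly_mapping_eqI) (auto simp: lookup_sum lookup_single when_def in_keys_iff)

text \<open>On monomials the exponents add and \<open>mon\<close> is multiplicative; bilinearity
  extends this to all polynomials, each being the sum of its monomial terms.\<close>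

lemma substitute_mult: "substitute s (p * q) = substitute s p * substitute s q"
proof -
  define mon where "mon e = (\<Prod>i\<in>Poly_Mapping.keys e. s i ^ Poly_Mapping.lookup e i)" for e
  have mon: "mon e = (\<Prod>i\<in>A. s i ^ Poly_Mapping.lookup e i)"
    if "finite A" "Poly_Mapping.keys e \<subseteq> A" for e A
    unfolding mon_def using that by (intro prod.mono_neutral_left) (auto simp: in_keys_iff)
  have "mon (e + f) = mon e * mon f" for e f
    using Poly_Mapping.keys_add[of e f]
    by (simp add: mon[of "Poly_Mapping.keys e \<union> Poly_Mapping.keys f"]
        lookup_add power_add prod.distrib)
  then have single: "substitute s (Poly_Mapping.single e a * Poly_Mapping.single f b) =
      substitute s (Poly_Mapping.single e a) * substitute s (Poly_Mapping.single f b)" for e f a b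
    by (simp add: mult_single substitute_single flip: mon_def) (simp add: const_polyfun_simps)
  have "substitute s ((\<Sum>i\<in>A. Poly_Mapping.single (f i) (a i)) * (\<Sum>j\<in>B. Poly_Mapping.single (g j) (b j))) =
      substitute s (\<Sum>i\<in>A. Poly_Mapping.single (f i) (a i)) *
      substitute s (\<Sum>j\<in>B. Poly_Mapping.single (g j) (b j))" for A B f g a b
    by (simp add: sum_product substitute_sum single)
  from this[of "\<lambda>e. e" "Poly_Mapping.lookup p" "Poly_Mapping.keys p"
      "\<lambda>e. e" "Poly_Mapping.lookup q" "Poly_Mapping.keys q"]
  show ?thesis by (simp flip: poly_mapping_eq_sum_single)
qed

lemma substitute_1 [simp]: "substitute s 1 = 1"
  by (simp add: substitute_single const_polyfun_simps flip: single_one)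

lemma substitute_power: "substitute s (p ^ k) = substitute s p ^ k"
  by (induction k) (auto simp: substitute_mult)

lemma substitute_const: "substitute s (poly_const r) = const_polyfun r"
  by (simp add: poly_const_def substitute_single)

lemma substitute_var: "substitute s (poly_var i) = s i"
  by (simp add: poly_var_def substitute_single const_polyfun_simps)

section \<open>Constant rational functions from generic values\<close>

text \<open>Over the common denominator the sum becomes one fraction, whose numerator is compared
  with \<open>r\<close> times the denominator. The zero set of \<open>R\<close> is a further
  exceptional set on which nothing is assumed; it is removed by cancelling \<open>R\<close> in the
  integral domain of polynomial functions.\<close>

lemma sum_Fract_eq_const:
  fixes a b :: "'i \<Rightarrow> 'a::euclidean_space polyfun"
  assumes A: "finite A" "\<And>i. i \<in> A \<Longrightarrow> b i \<noteq> 0" and "R \<noteq> 0"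
    and const: "\<And>u. apply_polyfun R u \<noteq> 0 \<Longrightarrow> (\<forall>i\<in>A. apply_polyfun (b i) u \<noteq> 0) \<Longrightarrow>
          (\<Sum>i\<in>A. apply_polyfun (a i) u / apply_polyfun (b i) u) = r"
  shows "(\<Sum>i\<in>A. Fract (a i) (b i)) = Fract (const_polyfun r) 1"
proof -
  have "\<exists>P. (\<Sum>i\<in>A. Fract (a i) (b i)) = Fract P (\<Prod>i\<in>A. b i) \<and>
     (\<forall>u. (\<forall>i\<in>A. apply_polyfun (b i) u \<noteq> 0) \<longrightarrow>
        apply_polyfun P u = (\<Prod>i\<in>A. apply_polyfun (b i) u) *
          (\<Sum>i\<in>A. apply_polyfun (a i) u / apply_polyfun (b i) u))"
    using A
  proof (induction A rule: finite_induct)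
    case empty
    show ?case by (rule exI[of _ 0]) (simp add: Zero_fract_def)
  next
    case (insert i A)
    then obtain P where P: "(\<Sum>i\<in>A. Fract (a i) (b i)) = Fract P (\<Prod>i\<in>A. b i)"
      "\<And>u. (\<forall>i\<in>A. apply_polyfun (b i) u \<noteq> 0) \<Longrightarrow>
        apply_polyfun P u = (\<Prod>i\<in>A. apply_polyfun (b i) u) *
          (\<Sum>i\<in>A. apply_polyfun (a i) u / apply_polyfun (b i) u)"
      by auto
    have "(\<Prod>i\<in>A. b i) \<noteq> 0" "b i \<noteq> 0" using insert by auto
    then have "(\<Sum>i\<in>insert i A. Fract (a i) (b i)) =
        Fract (a i * (\<Prod>i\<in>A. b i) + P * b i) (\<Prod>i\<in>insert i A. b i)"
      using insert.hyps by (simp add: P(1))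
    then show ?case
      using insert.hyps
      by (intro exI[of _ "a i * (\<Prod>i\<in>A. b i) + P * b i"])
        (auto simp: P(2) apply_polyfun_prod field_simps)
  qed
  then obtain P where P: "(\<Sum>i\<in>A. Fract (a i) (b i)) = Fract P (\<Prod>i\<in>A. b i)"
    "\<And>u. (\<forall>i\<in>A. apply_polyfun (b i) u \<noteq> 0) \<Longrightarrow>
        apply_polyfun P u = (\<Prod>i\<in>A. apply_polyfun (b i) u) *
          (\<Sum>i\<in>A. apply_polyfun (a i) u / apply_polyfun (b i) u)"
    by auto
  have nz: "(\<Prod>i\<in>A. b i) \<noteq> 0" using A by simp
  \<comment> \<open>At every point either the assumption makes the first factor vanish, or
    \<open>R\<close> or some \<open>b i\<close>, and with it the second factor, is zero.\<close>
  have "(P - const_polyfun r * (\<Prod>i\<in>A. b i)) * (R * (\<Prod>i\<in>A. b i)) = 0"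
  proof (rule polyfun_eqI)
    fix u
    show "apply_polyfun ((P - const_polyfun r * (\<Prod>i\<in>A. b i)) * (R * (\<Prod>i\<in>A. b i))) u
      = apply_polyfun 0 u"
    proof (cases "apply_polyfun R u \<noteq> 0 \<and> (\<forall>i\<in>A. apply_polyfun (b i) u \<noteq> 0)")
      case True
      then show ?thesis using P(2)[of u] const[of u] by (simp add: apply_polyfun_prod)
    next
      case False
      then show ?thesis using A(1) by (auto simp: apply_polyfun_prod)
    qed
  qed
  then have "P = const_polyfun r * (\<Prod>i\<in>A. b i)" using nz \<open>R \<noteq> 0\<close> by simp
  then show ?thesis using nz by (simp add: P(1) eq_fract)
qed

text \<open>Gives the uniqueness behind the definite description in
  \<open>multifan_integral\<close>.\<close>

lemma Fract_const_polyfun_eq_iff: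
  "Fract (const_polyfun r :: 'a::euclidean_space polyfun) 1 = Fract (const_polyfun s) 1 \<longleftrightarrow> r = s"
  by (metis apply_polyfun_simps(6) eq_fract(1) mult.right_neutral zero_neq_one)

section \<open>Volumes of parallelepipeds\<close>

text \<open>A type-level index set of size \<open>DIM('a)\<close>, which makes the change of variables formula of
  \<open>real ^ 'n\<close> available on an arbitrary Euclidean space.\<close>

typedef (overloaded) 'a dim_index = "{..<DIM('a::euclidean_space)}"
  morphisms index_nat nat_index
  by (rule exI[of _ 0]) simp

instance dim_index :: (euclidean_space) finite
proof
  have "finite (range (index_nat :: 'a dim_index \<Rightarrow> nat))"
    by (rule finite_subset[of _ "{..<DIM('a)}"]) (use index_nat in auto)
  then show "finite (UNIV :: 'a dim_index set)"
    by (rule finite_imageD) (simp add: index_nat_inject inj_on_def)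
qed

text \<open>The formula for the measure of a linear image in \<open>real ^ 'n\<close> asks for a
  well-ordered index type; the order is pulled back from the natural numbers.\<close>

instantiation dim_index :: (euclidean_space) linorder
begin

definition less_eq_dim_index :: "'a dim_index \<Rightarrow> 'a dim_index \<Rightarrow> bool" where
  "i \<le> j \<longleftrightarrow> index_nat i \<le> index_nat j"

definition less_dim_index :: "'a dim_index \<Rightarrow> 'a dim_index \<Rightarrow> bool" where
  "i < j \<longleftrightarrow> index_nat i < index_nat j"

instance
  by standard (auto simp: less_eq_dim_index_def less_dim_index_def index_nat_inject)

end

instance dim_index :: (euclidean_space) wellorder
proof
  fix P :: "'a dim_index \<Rightarrow> bool" and i
  assume step: "\<And>i. (\<And>j. j < i \<Longrightarrow> P j) \<Longrightarrow> P i"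
  show "P i"
  proof (induction i rule: measure_induct_rule[of index_nat])
    case (less i)
    show ?case by (rule step) (rule less, simp add: less_dim_index_def)
  qed
qed

lemma bij_betw_index_nat: "bij_betw (index_nat :: 'a::euclidean_space dim_index \<Rightarrow> nat) UNIV {..<DIM('a)}"
  using type_definition.Rep_range[OF type_definition_dim_index]
  by (auto simp: bij_betw_def inj_on_def index_nat_inject)

lemma bij_betw_nth_index_nat:
  assumes "distinct xs" "length xs = DIM('a::euclidean_space)"
  shows "bij_betw (\<lambda>i :: 'a dim_index. xs ! index_nat i) UNIV (set xs)"
  using bij_betw_trans[OF bij_betw_index_nat bij_betw_nth[OF assms(1) arg_cong[OF assms(2)[symmetric], of lessThan] refl]]
  by (simp add: comp_def)

text \<open>Links the determinant indexed by a finite type, which governs volumes, to the one of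
  matrices indexed by numbers, which governs orientations. Transport along \<open>index_nat\<close>
  is a bijection between the permutations in the two Leibniz formulas and preserves signs.\<close>

lemma det_index_nat:
  fixes A :: "real mat"
  assumes A: "A \<in> carrier_mat DIM('a::euclidean_space) DIM('a)"
  shows "Determinants.det (\<chi> i j :: 'a dim_index. A $$ (index_nat i, index_nat j)) = Determinant.det A"
proof -
  let ?n = "DIM('a)"
  let ?f = "index_nat :: 'a dim_index \<Rightarrow> nat"
  let ?P = "\<lambda>p. map_permutation UNIV ?f p"
  have f: "bij_betw ?f UNIV {0..<?n}" using bij_betw_index_nat[where 'a='a] by (simp add: lessThan_atLeast0)
  have inj: "inj ?f" using f by (rule bij_betw_imp_inj_on)
  have P: "?P p (?f i) = ?f (p i)" for p i using map_permutation_apply[OF inj] by simp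
  have "bij_betw ?P {p. p permutes UNIV} {p. p permutes {0..<?n}}"
  proof -
    have "?P = (\<lambda>p x. if x \<in> {0..<?n} then ?f (p (inv_into UNIV ?f x)) else x)"
      using f by (auto simp: map_permutation_def restrict_id_def bij_betw_def fun_eq_iff)
    then show ?thesis using bij_betw_permutations[OF f] by simp
  qed
  then have "Determinant.det A =
      (\<Sum>p | p permutes (UNIV :: 'a dim_index set).
         of_int (sign (?P p)) * (\<Prod>i = 0..<?n. A $$ (i, ?P p i)))"
    unfolding det_def'[OF A] by (simp add: sum.reindex_bij_betw[symmetric])
  also have "\<dots> = (\<Sum>p | p permutes (UNIV :: 'a dim_index set).
         of_int (sign p) * (\<Prod>i\<in>UNIV. A $$ (?f i, ?f (p i))))"
  proof (intro sum.cong refl arg_cong2[of _ _ _ _ "(*)"])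
    fix p :: "'a dim_index \<Rightarrow> 'a dim_index" assume "p \<in> {p. p permutes UNIV}"
    then show "of_int (sign (?P p)) = (of_int (sign p) :: real)"
      using sign_map_permutation[OF inj, of p] by simp
    show "(\<Prod>i = 0..<?n. A $$ (i, ?P p i)) = (\<Prod>i\<in>UNIV. A $$ (?f i, ?f (p i)))"
      using prod.reindex_bij_betw[OF f, of "\<lambda>i. A $$ (i, ?P p i)"] by (simp add: P)
  qed
  finally show ?thesis by (simp add: Determinants.det_def)
qed

text \<open>The map takes the standard basis to an orthonormal basis, so preimages of boxes are
  boxes with the same side lengths. The image measure therefore agrees with \<open>lborel\<close> on
  boxes, which determines it. Compactness makes both sets Borel.\<close>

lemma measure_lebesgue_isometry_image:
  fixes h :: "'n::finite \<Rightarrow> 'a::euclidean_space"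
  assumes h: "bij_betw h UNIV Basis" and S: "compact (S :: (real ^ 'n) set)"
  shows "measure lebesgue ((\<lambda>x. \<Sum>i\<in>UNIV. vec_nth x i *\<^sub>R h i) ` S) = measure lebesgue S"
proof -
  let ?\<phi> = "\<lambda>x. \<Sum>i\<in>UNIV. vec_nth x i *\<^sub>R h i"
  have inj: "inj h" and hB: "h i \<in> Basis" for i using h by (auto simp: bij_betw_def)
  have inner: "?\<phi> x \<bullet> h i = vec_nth x i" for x i
    using inj hB by (simp add: inner_sum_left inner_Basis inj_eq if_distrib cong: if_cong)
  have cont: "continuous_on UNIV ?\<phi>" by (intro continuous_intros)
  have meas: "?\<phi> \<in> borel_measurable borel" using cont by (rule borel_measurable_continuous_onI)
  have "(lborel :: 'a measure) = distr lborel borel ?\<phi>"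
  proof (rule lborel_eqI)
    fix l u :: 'a assume lu: "\<And>b. b \<in> Basis \<Longrightarrow> l \<bullet> b \<le> u \<bullet> b"
    have box: "?\<phi> -` box l u = box (\<chi> i. l \<bullet> h i) (\<chi> i. u \<bullet> h i)"
    proof (rule Set.set_eqI)
      fix x
      have "(\<forall>b\<in>Basis. P b) \<longleftrightarrow> (\<forall>i. P (h i))" for P
        using h by (force simp: bij_betw_def)
      then show "x \<in> ?\<phi> -` box l u \<longleftrightarrow> x \<in> box (\<chi> i. l \<bullet> h i) (\<chi> i. u \<bullet> h i)"
        unfolding vimage_eq mem_box_cart mem_box(1)[of _ l u] by (simp only: inner vec_lambda_beta)
    qed
    have "emeasure (distr lborel borel ?\<phi>) (box l u) = emeasure lborel (?\<phi> -` box l u)"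
      using meas by (subst emeasure_distr) auto
    also have "\<dots> = (\<Prod>b\<in>Basis. (u - l) \<bullet> b)"
    proof -
      have "(\<Prod>b\<in>Basis. ((\<chi> i. u \<bullet> h i) - (\<chi> i. l \<bullet> h i) :: real ^ 'n) \<bullet> b) = (\<Prod>i\<in>UNIV. (u - l) \<bullet> h i)"
        unfolding Basis_vec_def
        by (simp add: prod.UNION_disjoint axis_eq_axis inner_axis inner_diff_left)
      also have "\<dots> = (\<Prod>b\<in>Basis. (u - l) \<bullet> b)"
        using h by (rule prod.reindex_bij_betw)
      finally show ?thesis unfolding box
        by (subst emeasure_lborel_box) (auto simp: Basis_vec_def inner_axis lu hB)
    qed
    finally show "emeasure (distr lborel borel ?\<phi>) (box l u) = (\<Prod>b\<in>Basis. (u - l) \<bullet> b)" .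
  qed simp
  then have *: "measure lborel (?\<phi> ` S) = measure (distr lborel borel ?\<phi>) (?\<phi> ` S)"
    by (rule arg_cong2[of _ _ _ _ measure]) (rule refl)
  have "compact (?\<phi> ` S)" using S cont by (blast intro: compact_continuous_image continuous_on_subset)
  then have borel: "?\<phi> ` S \<in> sets borel" by (rule borel_compact)
  have "inj ?\<phi>" by (rule injI) (metis inner vec_eq_iff)
  then have "?\<phi> -` ?\<phi> ` S = S" by (rule inj_vimage_image_eq)
  then have "measure lborel (?\<phi> ` S) = measure lborel S"
    unfolding * using meas borel by (subst measure_distr) auto
  then show ?thesis using borel borel_compact[OF S] by simp
qed

lemma length_ordered_basis:
  fixes bs :: "'a::euclidean_space list"
  assumes "ordered_basis bs"
  shows "length bs = DIM('a)"
  using assms basis_card_eq_dim[of "set bs" UNIV] distinct_card[of bs]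
  by (auto simp: ordered_basis_def lin_indep_family_def)

text \<open>In coordinates with respect to \<open>bs\<close>, the parallelepiped is the image of the unit cube
  under the transition matrix.\<close>

lemma abs_det_eq_det_transition_mat:
  fixes bs :: "'a::euclidean_space list"
  assumes bs: "ordered_basis bs"
  obtains C where "C > 0"
    "\<And>lam I. card I = DIM('a) \<Longrightarrow>
       abs_det lam I = C * \<bar>Determinant.det (transition_mat bs (listed lam I))\<bar>"
proof -
  have indep: "independent (set bs)" and span: "span (set bs) = UNIV" and dist: "distinct bs"
    using bs by (auto simp: ordered_basis_def lin_indep_family_def)
  note len = length_ordered_basis[OF bs]
  have bsb: "bij_betw (\<lambda>k :: 'a dim_index. bs ! index_nat k) UNIV (set bs)"
    by (rule bij_betw_nth_index_nat[OF dist len])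
  have "card (UNIV :: 'a dim_index set) = DIM('a)"
    using bij_betw_same_card[OF bij_betw_index_nat[where 'a='a]] by simp
  then obtain h :: "'a dim_index \<Rightarrow> 'a" where h: "bij_betw h UNIV Basis"
    using finite_same_card_bij[of "UNIV :: 'a dim_index set" "Basis :: 'a set"] by auto
  \<comment> \<open>\<open>g\<close> builds a vector from its coordinates in \<open>bs\<close>, and
    \<open>\<psi>\<close> reads off the coordinates of that vector in the orthonormal basis
    \<open>h\<close>. The constant sought is the absolute determinant of \<open>\<psi>\<close>, that
    is, the volume of the parallelepiped spanned by \<open>bs\<close>; it is fixed before
    \<open>lam\<close> and \<open>I\<close> are.\<close>
  define g :: "real ^ 'a dim_index \<Rightarrow> 'a" where "g x = (\<Sum>k\<in>UNIV. vec_nth x k *\<^sub>R bs ! index_nat k)" for x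
  define \<psi> :: "real ^ 'a dim_index \<Rightarrow> real ^ 'a dim_index" where "\<psi> x = (\<chi> i. g x \<bullet> h i)" for x
  have lin_g: "linear g"
    by (rule linearI) (simp_all add: g_def scaleR_add_left sum.distrib scaleR_sum_right)
  have lin: "linear \<psi>"
    by (rule linearI) (simp_all add: \<psi>_def vec_eq_iff linear_add[OF lin_g] linear_scale[OF lin_g] inner_add_left)
  have \<psi>: "(\<Sum>i\<in>UNIV. vec_nth (\<psi> x) i *\<^sub>R h i) = g x" for x
    using sum.reindex_bij_betw[OF h, of "\<lambda>b. (g x \<bullet> b) *\<^sub>R b"]
    by (simp add: \<psi>_def euclidean_representation)
  have g0: "x = 0" if "g x = 0" for x
  proof -
    let ?k = "inv_into UNIV (\<lambda>k :: 'a dim_index. bs ! index_nat k)"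
    have k: "?k (bs ! index_nat k) = k" for k
      using bij_betw_inv_into_left[OF bsb UNIV_I, of k] by simp
    have "(\<Sum>b\<in>set bs. vec_nth x (?k b) *\<^sub>R b) = g x"
      unfolding g_def sum.reindex_bij_betw[OF bsb, symmetric] k by simp
    then have zero: "vec_nth x (?k b) = 0" if "b \<in> set bs" for b
      using independentD[OF indep, of "set bs" "\<lambda>b. vec_nth x (?k b)"] \<open>g x = 0\<close> that by simp
    have "vec_nth x k = 0" for k
      using zero[OF bij_betw_apply[OF bsb UNIV_I[of k]]] unfolding k .
    then show ?thesis by (simp add: vec_eq_iff)
  qed
  have "inj \<psi>"
    unfolding linear_injective_0[OF lin]
  proof (intro allI impI)
    fix x assume "\<psi> x = 0"
    then have "g x = 0" using \<psi>[of x] by simp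
    then show "x = 0" by (rule g0)
  qed
  then have pos: "\<bar>Determinants.det (matrix \<psi>)\<bar> > 0"
    using det_nz_iff_inj[OF lin] by simp
  have image: "measure lebesgue (g ` S) = \<bar>Determinants.det (matrix \<psi>)\<bar> * measure lebesgue S"
    if S: "compact S" for S
  proof -
    have "g ` S = (\<lambda>x. \<Sum>i\<in>UNIV. vec_nth x i *\<^sub>R h i) ` \<psi> ` S" by (simp add: image_image \<psi>)
    moreover have "compact (\<psi> ` S)"
      using S lin by (intro compact_continuous_image linear_continuous_on) (simp add: linear_conv_bounded_linear)
    ultimately show ?thesis
      using measure_lebesgue_isometry_image[OF h] measure_linear_image[OF lin] S
      by (simp add: lmeasurable_compact)
  qed
  show thesis
  proof (rule that[OF pos])
    fix lam :: "nat \<Rightarrow> 'a" and I :: "nat set" assume I: "card I = DIM('a)"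
    \<comment> \<open>An infinite set has \<open>card\<close> 0, whereas \<open>DIM('a)\<close> is
      positive.\<close>
    then have fin: "finite I" by (metis card.infinite DIM_positive less_irrefl)
    define vs where "vs = listed lam I"
    define A where "A = transition_mat bs vs"
    have A: "A \<in> carrier_mat DIM('a) DIM('a)" by (simp add: A_def transition_mat_def)
    define M :: "real ^ 'a dim_index ^ 'a dim_index" where
      "M = (\<chi> i j. A $$ (index_nat i, index_nat j))"
    have lin_M: "linear ((*v) M)" by simp
    have idx: "index_nat k < DIM('a)" for k :: "'a dim_index" using index_nat[of k] by simp
    have M: "vec_nth (vec_nth M i) k = representation (set bs) (vs ! index_nat k) (bs ! index_nat i)" for i k
      by (simp add: M_def A_def transition_mat_def idx)
    \<comment> \<open>The columns of \<open>M\<close> are the \<open>bs\<close>-coordinates of the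
      vectors in \<open>vs\<close>, so \<open>g\<close> after \<open>M\<close> sends the unit
      vectors to \<open>vs\<close> and the unit cube to the parallelepiped.\<close>
    have gM: "g (M *v x) = (\<Sum>k\<in>UNIV. vec_nth x k *\<^sub>R vs ! index_nat k)" for x
    proof -
      have "g (M *v x) = (\<Sum>k\<in>UNIV. \<Sum>i\<in>UNIV. (vec_nth (vec_nth M i) k * vec_nth x k) *\<^sub>R bs ! index_nat i)"
        unfolding g_def by (subst sum.swap) (simp add: matrix_vector_mult_def scaleR_sum_left)
      also have "\<dots> = (\<Sum>k\<in>UNIV. vec_nth x k *\<^sub>R (\<Sum>b\<in>set bs. representation (set bs) (vs ! index_nat k) b *\<^sub>R b))"
        unfolding sum.reindex_bij_betw[OF bsb, symmetric] by (simp add: M scaleR_sum_right mult.commute)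
      finally show ?thesis
        using indep span by (simp add: sum_representation_eq)
    qed
    let ?xs = "sorted_list_of_set I"
    have xs: "bij_betw (\<lambda>k :: 'a dim_index. ?xs ! index_nat k) UNIV I"
      using bij_betw_nth_index_nat[of ?xs, where 'a='a] fin I by simp
    have vs: "vs ! index_nat k = lam (?xs ! index_nat k)" for k :: "'a dim_index"
      using idx[of k] I by (simp add: vs_def listed_def)
    have "parallelepiped lam I = g ` ((*v) M ` cbox 0 1)"
    proof (intro Set.set_eqI iffI)
      fix p assume "p \<in> parallelepiped lam I"
      then obtain t where t: "p = (\<Sum>i\<in>I. t i *\<^sub>R lam i)" "\<forall>i\<in>I. 0 \<le> t i \<and> t i \<le> 1"
        by (auto simp: parallelepiped_def)
      define x :: "real ^ 'a dim_index" where "x = (\<chi> k. t (?xs ! index_nat k))"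
      have "p = g (M *v x)"
        unfolding gM t(1) sum.reindex_bij_betw[OF xs, symmetric] by (simp add: vs x_def)
      moreover have "x \<in> cbox 0 1"
        using t(2) bij_betwE[OF xs] by (simp add: mem_box_cart x_def)
      ultimately show "p \<in> g ` ((*v) M ` cbox 0 1)" by blast
    next
      fix p assume "p \<in> g ` ((*v) M ` cbox 0 1)"
      then obtain x where x: "p = g (M *v x)" "x \<in> cbox 0 1" by blast
      let ?k = "inv_into UNIV (\<lambda>k :: 'a dim_index. ?xs ! index_nat k)"
      have k: "?k (?xs ! index_nat k) = k" for k
        using bij_betw_inv_into_left[OF xs UNIV_I, of k] by simp
      have "p = (\<Sum>i\<in>I. vec_nth x (?k i) *\<^sub>R lam i)"
        unfolding x gM sum.reindex_bij_betw[OF xs, symmetric] k by (simp add: vs)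
      then show "p \<in> parallelepiped lam I"
        using x(2) by (auto simp: parallelepiped_def mem_box_cart)
    qed
    moreover have "compact ((*v) M ` cbox 0 1)"
      by (intro compact_continuous_image compact_cbox linear_continuous_on)
        (simp add: linear_conv_bounded_linear[symmetric])
    moreover have "measure lebesgue (cbox (0 :: real ^ 'a dim_index) 1) = 1"
      by (simp add: content_cbox_cart interval_ne_empty_cart)
    moreover have "matrix ((*v) M) = M" by simp
    ultimately have "abs_det lam I = \<bar>Determinants.det (matrix \<psi>)\<bar> * \<bar>Determinants.det M\<bar>"
      unfolding abs_det_def using measure_linear_image[OF lin_M, of "cbox 0 1"] image by simp
    also have "Determinants.det M = Determinant.det A"
      unfolding M_def by (rule det_index_nat[OF A])
    finally show "abs_det lam I = \<bar>Determinants.det (matrix \<psi>)\<bar> *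
        \<bar>Determinant.det (transition_mat bs (listed lam I))\<bar>"
      by (simp add: A_def vs_def)
  qed
qed

section \<open>Dual bases and Cramer's rule\<close>

lemma set_listed: "finite I \<Longrightarrow> set (listed lam I) = lam ` I"
  by (simp add: listed_def)

lemma length_listed [simp]: "length (listed lam I) = card I"
  by (simp add: listed_def)

lemma ordered_basis_listedD:
  assumes "ordered_basis (listed lam I)" "finite I"
  shows "inj_on lam I" "independent (lam ` I)" "span (lam ` I) = UNIV"
  using assms by (auto simp: ordered_basis_def lin_indep_family_def set_listed) (simp add: listed_def distinct_map)

context
  fixes lam :: "nat \<Rightarrow> 'a::euclidean_space" and I :: "nat set"
  assumes basis: "ordered_basis (listed lam I)" and fin: "finite I"
begin

text \<open>Existence comes from linear extension off an independent set, uniqueness from spanning.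
  The extension is prescribed on vectors; injectivity of \<open>lam\<close> on \<open>I\<close>
  turns this into a condition on indices.\<close>

lemma dual_basis_vector:
  assumes j: "j \<in> I"
  shows "linear (dual_basis_vector lam I j)"
    and "\<And>i. i \<in> I \<Longrightarrow> dual_basis_vector lam I j (lam i) = (if i = j then 1 else 0)"
proof -
  note B = ordered_basis_listedD[OF basis fin]
  obtain u :: "'a \<Rightarrow> real" where u: "linear u" "\<And>x. x \<in> lam ` I \<Longrightarrow> u x = (if x = lam j then 1 else 0)"
    using linear_independent_extend[OF B(2), of "\<lambda>x. if x = lam j then 1 else 0 :: real"] by blast
  have "\<exists>!u. linear u \<and> (\<forall>i\<in>I. u (lam i) = (if i = j then 1 else 0 :: real))"
  proof (rule ex1I)
    show "linear u \<and> (\<forall>i\<in>I. u (lam i) = (if i = j then 1 else 0))"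
      using u j B(1) by (auto simp: inj_on_def)
    then show "u' = u" if "linear u' \<and> (\<forall>i\<in>I. u' (lam i) = (if i = j then 1 else 0))" for u'
      using that B(3) linear_eq_on_span[of u' u "lam ` I"] by fastforce
  qed
  from theI'[OF this]
  show "linear (dual_basis_vector lam I j)"
    and "\<And>i. i \<in> I \<Longrightarrow> dual_basis_vector lam I j (lam i) = (if i = j then 1 else 0)"
    by (auto simp: dual_basis_vector_def)
qed

lemma dual_basis_vector_sum:
  assumes "j \<in> I"
  shows "dual_basis_vector lam I j (\<Sum>i\<in>I. a i *\<^sub>R lam i) = a j"
proof -
  have "dual_basis_vector lam I j (\<Sum>i\<in>I. a i *\<^sub>R lam i) = (\<Sum>i\<in>I. a i * dual_basis_vector lam I j (lam i))"
    using dual_basis_vector(1)[OF assms] by (simp add: linear_sum linear_scale)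
  also have "\<dots> = (\<Sum>i\<in>I. if i = j then a i else 0)"
    by (intro sum.cong refl) (simp add: dual_basis_vector(2)[OF assms])
  finally show ?thesis using assms fin by simp
qed

lemma sum_dual_basis_vector: "(\<Sum>i\<in>I. dual_basis_vector lam I i v *\<^sub>R lam i) = v"
proof (rule linear_eq_on_span[of _ "\<lambda>v. v" "lam ` I"])
  show "linear (\<lambda>v. \<Sum>i\<in>I. dual_basis_vector lam I i v *\<^sub>R lam i)"
    by (intro linearI) (simp_all add: linear_add linear_scale dual_basis_vector(1) scaleR_add_left
        sum.distrib scaleR_sum_right cong: sum.cong)
  show "v \<in> span (lam ` I)" by (simp add: ordered_basis_listedD[OF basis fin])
  fix x assume "x \<in> lam ` I"
  then obtain i where i: "i \<in> I" "x = lam i" by blast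
  then have "(\<Sum>j\<in>I. dual_basis_vector lam I j x *\<^sub>R lam j) = (\<Sum>j\<in>I. if j = i then lam i else 0)"
    by (intro sum.cong) (auto simp: dual_basis_vector)
  then show "(\<Sum>i\<in>I. dual_basis_vector lam I i x *\<^sub>R lam i) = x" using i fin by simp
qed (simp add: linear_ident)

text \<open>Coordinates given by \<open>representation\<close> do not change when an independent set
  is enlarged, so this form lets coordinates with respect to \<open>I\<close> be compared with those
  with respect to a face of \<open>I\<close>.\<close>

lemma dual_basis_vector_eq_representation:
  assumes "j \<in> I"
  shows "dual_basis_vector lam I j v = representation (lam ` I) v (lam j)"
proof -
  note B = ordered_basis_listedD[OF basis fin]
  have "(\<Sum>i\<in>I. representation (lam ` I) v (lam i) *\<^sub>R lam i) = v"
    using sum_representation_eq[of "lam ` I" v "lam ` I"] B fin by (simp add: sum.reindex)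
  then show ?thesis using dual_basis_vector_sum[OF assms] by metis
qed

lemma apply_Polyfun_dual_basis_vector:
  assumes "j \<in> I"
  shows "apply_polyfun (Polyfun (dual_basis_vector lam I j)) v = dual_basis_vector lam I j v"
  using dual_basis_vector(1)[OF assms]
  by (subst Polyfun_inverse) (auto simp: linear_conv_bounded_linear intro: real_polynomial_function.intros)

lemma apply_iota_linear_form_power:
  assumes "I \<subseteq> A" "finite A"
  shows "apply_polyfun (iota lam I ((\<Sum>i\<in>A. poly_const (c i) * poly_var i) ^ k)) v =
    (\<Sum>i\<in>I. dual_basis_vector lam I i v * c i) ^ k"
proof -
  have "(\<Sum>i\<in>A. apply_polyfun (const_polyfun (c i) * (if i \<in> I then Polyfun (dual_basis_vector lam I i) else 0)) v)
     = (\<Sum>i\<in>I. dual_basis_vector lam I i v * c i)"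
    using assms by (intro sum.mono_neutral_cong_right) (auto simp: apply_Polyfun_dual_basis_vector)
  then show ?thesis
    by (simp add: iota_def substitute_power substitute_sum substitute_mult substitute_const
        substitute_var apply_polyfun_power apply_polyfun_sum)
qed

lemma iota_var: "i \<in> I \<Longrightarrow> iota lam I (poly_var i) = Polyfun (dual_basis_vector lam I i)"
  by (simp add: iota_def substitute_var)

end

section \<open>Determinants of transition matrices\<close>

lemma transition_mat_carrier [simp]:
  "transition_mat bs (vs :: 'a::euclidean_space list) \<in> carrier_mat DIM('a) DIM('a)"
  by (simp add: transition_mat_def)

text \<open>The transition matrix in the opposite direction is an inverse.\<close>

lemma det_transition_mat_nonzero:
  fixes bs :: "'a::euclidean_space list"
  assumes bs: "ordered_basis bs" and vs: "ordered_basis vs"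
  shows "Determinant.det (transition_mat bs vs) \<noteq> 0"
proof -
  have b: "independent (set bs)" "span (set bs) = UNIV" "distinct bs"
    and v: "independent (set vs)" "span (set vs) = UNIV" "distinct vs"
    using bs vs by (auto simp: ordered_basis_def lin_indep_family_def)
  note lb = length_ordered_basis[OF bs] and lv = length_ordered_basis[OF vs]
  have "transition_mat bs vs * transition_mat vs bs = 1\<^sub>m DIM('a)"
  proof (rule eq_matI)
    fix i j assume "i < dim_row (1\<^sub>m DIM('a) :: real mat)" "j < dim_col (1\<^sub>m DIM('a) :: real mat)"
    then have ij: "i < DIM('a)" "j < DIM('a)" by auto
    have "(transition_mat bs vs * transition_mat vs bs) $$ (i, j) =
        (\<Sum>k<DIM('a). representation (set bs) (vs ! k) (bs ! i) * representation (set vs) (bs ! j) (vs ! k))"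
      using ij by (simp add: transition_mat_def scalar_prod_def lessThan_atLeast0)
    also have "\<dots> = (\<Sum>x\<in>set vs. representation (set bs) x (bs ! i) * representation (set vs) (bs ! j) x)"
      using sum.reindex_bij_betw[OF bij_betw_nth[OF v(3) refl refl]] lv by simp
    also have "\<dots> = representation (set bs) (\<Sum>x\<in>set vs. representation (set vs) (bs ! j) x *\<^sub>R x) (bs ! i)"
      using b by (simp add: representation_sum representation_scale mult.commute)
    also have "(\<Sum>x\<in>set vs. representation (set vs) (bs ! j) x *\<^sub>R x) = bs ! j"
      using v by (intro sum_representation_eq) auto
    also have "representation (set bs) (bs ! j) (bs ! i) = (if i = j then 1 else 0)"
      using b ij lb by (simp add: representation_basis nth_eq_iff_index_eq)
    finally show "(transition_mat bs vs * transition_mat vs bs) $$ (i, j) = 1\<^sub>m DIM('a) $$ (i, j)"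
      using ij by simp
  qed (simp_all add: transition_mat_def)
  then have "Determinant.det (transition_mat bs vs) * Determinant.det (transition_mat vs bs) = 1"
    by (metis Determinant.det_mult transition_mat_carrier Determinant.det_one)
  then show ?thesis by auto
qed

text \<open>The minor depends on \<open>xs\<close> and \<open>ys\<close> only through
  \<open>xs @ ys\<close>, and not on \<open>u\<close>: the place of \<open>u\<close> in the list is
  forgotten.\<close>

lemma mat_delete_transition_mat:
  assumes "length xs + length ys + 1 = DIM('a::euclidean_space)" "i < DIM('a)"
  shows "mat_delete (transition_mat bs (xs @ u # ys :: 'a list)) i (length xs) =
    Matrix.mat (DIM('a) - 1) (DIM('a) - 1)
      (\<lambda>(k, l). representation (set bs) ((xs @ ys) ! l) (bs ! (if k < i then k else Suc k)))"
  using assms by (intro eq_matI) (auto simp: mat_delete_def transition_mat_def nth_append Suc_diff_le)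

text \<open>Laplace expansion along the column of \<open>u\<close>, arranged so that the place of
  \<open>u\<close> enters only through a sign. Both linearity in \<open>u\<close> and the sign for
  moving \<open>u\<close> to the front follow from it.\<close>

lemma det_transition_mat_expand:
  fixes xs :: "'a::euclidean_space list"
  assumes "length xs + length ys + 1 = DIM('a)"
  shows "Determinant.det (transition_mat bs (xs @ u # ys)) =
    (\<Sum>i<DIM('a). representation (set bs) u (bs ! i) * ((-1) ^ (i + length xs) *
      Determinant.det (Matrix.mat (DIM('a) - 1) (DIM('a) - 1)
      (\<lambda>(k, l). representation (set bs) ((xs @ ys) ! l) (bs ! (if k < i then k else Suc k))))))"
proof -
  have k: "length xs < DIM('a)" using assms by simp
  have "transition_mat bs (xs @ u # ys) $$ (i, length xs) = representation (set bs) u (bs ! i)" if "i < DIM('a)" for i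
    using that k by (simp add: transition_mat_def)
  then show ?thesis
    unfolding laplace_expansion_column[OF transition_mat_carrier k] Determinant.cofactor_def
    by (intro sum.cong refl) (simp only: lessThan_iff mat_delete_transition_mat[OF assms])
qed

lemma det_transition_mat_Cons_move:
  fixes xs :: "'a::euclidean_space list"
  assumes "length xs + length ys + 1 = DIM('a)"
  shows "Determinant.det (transition_mat bs (u # xs @ ys)) =
    (-1) ^ length xs * Determinant.det (transition_mat bs (xs @ u # ys))"
proof -
  have "Determinant.det (transition_mat bs (u # xs @ ys)) =
      Determinant.det (transition_mat bs ([] @ u # xs @ ys))" by simp
  then show ?thesis
    using det_transition_mat_expand[of "[]" "xs @ ys" bs u] det_transition_mat_expand[of xs ys bs u] assms
    by (simp add: sum_distrib_left power_add mult_ac flip: power_mult_distrib)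
qed

lemma det_transition_mat_Cons_sum:
  fixes bs :: "'a::euclidean_space list"
  assumes bs: "ordered_basis bs" and vs: "length vs + 1 = DIM('a)"
  shows "Determinant.det (transition_mat bs ((\<Sum>i\<in>A. a i *\<^sub>R f i) # vs)) =
    (\<Sum>i\<in>A. a i * Determinant.det (transition_mat bs (f i # vs)))"
proof -
  have "independent (set bs)" "span (set bs) = UNIV"
    using bs by (auto simp: ordered_basis_def lin_indep_family_def)
  then have "representation (set bs) (\<Sum>i\<in>A. a i *\<^sub>R f i) b = (\<Sum>i\<in>A. a i * representation (set bs) (f i) b)" for b
    by (simp add: representation_sum representation_scale)
  then show ?thesis
    using det_transition_mat_expand[of "[]" vs bs] vs
    by (simp add: sum_distrib_right sum_distrib_left mult.assoc) (rule sum.swap)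
qed

lemma det_transition_mat_Cons_member:
  fixes vs :: "'a::euclidean_space list"
  assumes "u \<in> set vs" "length vs + 1 = DIM('a)"
  shows "Determinant.det (transition_mat bs (u # vs)) = 0"
proof -
  obtain k where k: "k < length vs" "vs ! k = u" using assms by (auto simp: in_set_conv_nth)
  show ?thesis
    by (rule Determinant.det_identical_columns[of _ "DIM('a)" 0 "Suc k"])
      (use assms(2) k in \<open>auto simp: transition_mat_def intro!: eq_vecI\<close>)
qed

text \<open>The length of \<open>xs\<close> is the exponent of the sign in
  \<open>simplex_boundary\<close>, so moving \<open>j\<close> to the front of the sorted list
  produces exactly the incidence sign of the face.\<close>

lemma sorted_list_of_set_split:
  fixes j :: "'a::linorder"
  assumes "finite I" "j \<in> I"
  obtains xs ys where "sorted_list_of_set I = xs @ j # ys" "sorted_list_of_set (I - {j}) = xs @ ys"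
    "length xs = card {i \<in> I. i < j}"
proof -
  obtain xs ys where split: "sorted_list_of_set I = xs @ j # ys"
    using assms by (metis set_sorted_list_of_set split_list)
  have sorted: "sorted_wrt (<) (xs @ j # ys)"
    using strict_sorted_list_of_set[of I] split by simp
  then have "j \<notin> set xs" by (auto simp: sorted_wrt_append)
  then have "sorted_list_of_set (I - {j}) = xs @ ys"
    using assms split by (simp add: sorted_list_of_set_remove remove1_append)
  moreover have "set xs = {i \<in> I. i < j}"
    using arg_cong[OF split, of set] assms(1) sorted by (auto simp: sorted_wrt_append)
  moreover have "distinct xs"
    using distinct_sorted_list_of_set[of I] split by simp
  ultimately show thesis using that split distinct_card by metis
qed

text \<open>Expanding \<open>u\<close> in the basis indexed by \<open>I\<close> leaves only the term
  of \<open>lam j\<close>, the others having a repeated column; putting \<open>lam j\<close> back in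
  its sorted place gives the sign. The left-hand side depends on the face \<open>I - {j}\<close>
  alone, so different simplices sharing that face can be compared.\<close>

lemma cramer_transition_mat:
  fixes lam :: "nat \<Rightarrow> 'a::euclidean_space"
  assumes bs: "ordered_basis bs" and I: "finite I" "ordered_basis (listed lam I)" and j: "j \<in> I"
  shows "Determinant.det (transition_mat bs (u # listed lam (I - {j}))) =
    (-1) ^ card {i \<in> I. i < j} * (dual_basis_vector lam I j u * Determinant.det (transition_mat bs (listed lam I)))"
proof -
  obtain xs ys where split: "sorted_list_of_set I = xs @ j # ys" "sorted_list_of_set (I - {j}) = xs @ ys"
    "length xs = card {i \<in> I. i < j}" using sorted_list_of_set_split[OF I(1) j] .
  have n: "card I = DIM('a)" using length_ordered_basis[OF I(2)] by simp
  then have n': "length (listed lam (I - {j})) + 1 = DIM('a)"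
    using I(1) j by (simp add: card_Diff_singleton)
  have "Determinant.det (transition_mat bs (u # listed lam (I - {j}))) =
      (\<Sum>i\<in>I. dual_basis_vector lam I i u * Determinant.det (transition_mat bs (lam i # listed lam (I - {j}))))"
    by (subst sum_dual_basis_vector[OF I(2,1), of u, symmetric], rule det_transition_mat_Cons_sum[OF bs n'])
  also have "\<dots> = dual_basis_vector lam I j u * Determinant.det (transition_mat bs (lam j # listed lam (I - {j})))"
    using I(1) j n' by (subst sum.remove[OF _ j]) (auto simp: det_transition_mat_Cons_member set_listed intro!: sum.neutral)
  also have "Determinant.det (transition_mat bs (lam j # listed lam (I - {j}))) =
      (-1) ^ card {i \<in> I. i < j} * Determinant.det (transition_mat bs (listed lam I))"
    using det_transition_mat_Cons_move[of "map lam xs" "map lam ys" bs "lam j"] n'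
    by (simp add: listed_def split)
  finally show ?thesis by simp
qed

section \<open>Constancy of the localization sum\<close>

lemma finite_subsets_of_size: "finite (subsets_of_size m k)"
  by (rule finite_subset[of _ "Pow {1..m}"]) (auto simp: subsets_of_size_def)

lemma subsets_of_sizeD:
  "I \<in> subsets_of_size m k \<Longrightarrow> finite I" "I \<in> subsets_of_size m k \<Longrightarrow> I \<subseteq> {1..m}"
  by (auto simp: subsets_of_size_def intro: finite_subset)

text \<open>After exchanging the sums, the coefficient of \<open>H J\<close> is the coefficient of
  \<open>J\<close> in the boundary of \<open>z\<close>.\<close>

lemma cycle_sum_faces_eq_0:
  assumes "is_cycle m k z"
  shows "(\<Sum>I\<in>subsets_of_size m k. z I * (\<Sum>j\<in>I. (-1) ^ card {i \<in> I. i < j} * H (I - {j}))) = 0"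
proof -
  have "(\<Sum>j\<in>I. (-1) ^ card {i \<in> I. i < j} * H (I - {j})) = (\<Sum>J\<in>Pow {1..m}. simplex_boundary I J * H J)"
    if "I \<in> subsets_of_size m k" for I
  proof -
    have "(\<Sum>J\<in>Pow {1..m}. simplex_boundary I J * H J) =
       (\<Sum>j\<in>I. \<Sum>J\<in>Pow {1..m}. if J = I - {j} then (-1) ^ card {i \<in> I. i < j} * H J else 0)"
      unfolding simplex_boundary_def sum_distrib_right
      by (subst sum.swap) (simp add: if_distrib[of "\<lambda>x. x * _"] cong: if_cong)
    also have "\<dots> = (\<Sum>j\<in>I. (-1) ^ card {i \<in> I. i < j} * H (I - {j}))"
      using subsets_of_sizeD(2)[OF that] by (intro sum.cong) (auto simp: sum.delta)
    finally show ?thesis by simp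
  qed
  then have "(\<Sum>I\<in>subsets_of_size m k. z I * (\<Sum>j\<in>I. (-1) ^ card {i \<in> I. i < j} * H (I - {j})))
    = (\<Sum>I\<in>subsets_of_size m k. \<Sum>J\<in>Pow {1..m}. z I * simplex_boundary I J * H J)"
    by (simp add: sum_distrib_left mult.assoc)
  also have "\<dots> = (\<Sum>J\<in>Pow {1..m}. (\<Sum>I\<in>subsets_of_size m k. z I * simplex_boundary I J) * H J)"
    by (subst sum.swap) (simp add: sum_distrib_right)
  finally show ?thesis using assms by (simp add: is_cycle_def)
qed

lemma orientation_cases:
  assumes "ori \<in> orientations"
  obtains bs where "ordered_basis bs"
    "\<And>vs. ordered_basis vs \<Longrightarrow> vs \<in> ori \<longleftrightarrow> Determinant.det (transition_mat bs vs) > 0"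
proof -
  obtain bs where bs: "ordered_basis bs" "ori = same_orientation `` {bs}"
    using assms by (auto simp: orientations_def quotient_def)
  show thesis
    by (rule that[OF bs(1)]) (use bs in \<open>auto simp: same_orientation_def\<close>)
qed

text \<open>The family itself can serve as reference basis.\<close>

lemma abs_det_nonzero:
  assumes "ordered_basis (listed lam I)"
  shows "abs_det lam I \<noteq> 0"
proof -
  obtain C where "C > 0"
    "abs_det lam I = C * \<bar>Determinant.det (transition_mat (listed lam I) (listed lam I))\<bar>"
    using abs_det_eq_det_transition_mat[OF assms] length_ordered_basis[OF assms] by (metis length_listed)
  then show ?thesis using det_transition_mat_nonzero[OF assms assms] by simp
qed

text \<open>For each simplex, \<open>generic\<close> and \<open>distinct\<close> say that the line
  from \<open>u\<close> in direction \<open>v\<close> meets the hyperplanes of the faces at pairwise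
  distinct nonzero parameters, which is what \<open>power_div_prod_exchange\<close> asks for. The
  resulting terms are functions of the face only, and \<open>cycle_sum_faces_eq_0\<close> cancels
  them.\<close>

lemma multifan_value_eq:
  fixes lam :: "nat \<Rightarrow> 'a::euclidean_space" and u v :: 'a and c :: "nat \<Rightarrow> real"
  assumes ori: "ori \<in> orientations" and fan: "complete_simplicial_multifan ori m w lam"
    and generic: "\<And>I i. I \<in> subsets_of_size m DIM('a) \<Longrightarrow> w I \<noteq> 0 \<Longrightarrow> i \<in> I \<Longrightarrow>
        dual_basis_vector lam I i u \<noteq> 0 \<and> dual_basis_vector lam I i v \<noteq> 0"
    and distinct: "\<And>I i j. I \<in> subsets_of_size m DIM('a) \<Longrightarrow> w I \<noteq> 0 \<Longrightarrow> i \<in> I \<Longrightarrow> j \<in> I \<Longrightarrow> i \<noteq> j \<Longrightarrow>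
        dual_basis_vector lam I i u * dual_basis_vector lam I j v \<noteq>
        dual_basis_vector lam I j u * dual_basis_vector lam I i v"
  defines "S \<equiv> \<lambda>x. \<Sum>I | I \<in> subsets_of_size m DIM('a) \<and> w I \<noteq> 0.
      w I / (abs_det lam I * (\<Prod>i\<in>I. dual_basis_vector lam I i x)) *
      (\<Sum>i\<in>I. dual_basis_vector lam I i x * c i) ^ DIM('a)"
  shows "S u = S v"
proof -
  obtain bs where bs: "ordered_basis bs"
    and ori_iff: "\<And>vs. ordered_basis vs \<Longrightarrow> vs \<in> ori \<longleftrightarrow> Determinant.det (transition_mat bs vs) > 0"
    by (rule orientation_cases[OF ori]) blast
  obtain C where C: "C > 0" "\<And>lam I. card I = DIM('a) \<Longrightarrow>
       abs_det lam I = C * \<bar>Determinant.det (transition_mat bs (listed lam I))\<bar>"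
    using abs_det_eq_det_transition_mat[OF bs] by blast
  define D where "D I = Determinant.det (transition_mat bs (listed lam I))" for I
  \<comment> \<open>For \<open>J = I - {j}\<close> with \<open>w I \<noteq> 0\<close> this is, up to
    sign, \<open>D I\<close> times the \<open>j\<close>-th dual basis vector of \<open>I\<close>,
    yet it refers to \<open>J\<close> alone.\<close>
  define E where "E J x = Determinant.det (transition_mat bs (x # listed lam J))" for J x
  define z where "z I = w I * orientation_sign ori lam I" for I
  define F where "F I x = (\<Sum>i\<in>I. dual_basis_vector lam I i x * c i) ^ DIM('a) /
      (\<Prod>i\<in>I. dual_basis_vector lam I i x)" for I x
  \<comment> \<open>The line through \<open>u\<close> in direction \<open>v\<close> meets the hyperplane spanned by \<open>lam ` J\<close> in \<open>q J\<close>.\<close>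
  define q where "q J = u - (E J u / E J v) *\<^sub>R v" for J
  \<comment> \<open>Coordinates are taken in the vectors of \<open>J\<close> alone, so that
    \<open>H J\<close> is the same for all simplices containing \<open>J\<close>.\<close>
  define B where "B J i = representation (lam ` J) (q J) (lam i)" for J i
  define H where "H J = (\<Sum>i\<in>J. B J i * c i) ^ DIM('a) / (E J u * (\<Prod>i\<in>J. B J i))" for J
  have cycle: "is_cycle m DIM('a) z"
    and basis: "\<And>I. I \<in> subsets_of_size m DIM('a) \<Longrightarrow> w I \<noteq> 0 \<Longrightarrow> ordered_basis (listed lam I)"
    using fan by (auto simp: complete_simplicial_multifan_def z_def[abs_def])
  \<comment> \<open>The orientation sign is the sign of \<open>D I\<close>, so it absorbs the
    absolute value in \<open>abs_det\<close> and replaces the weight by the coefficient of the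
    cycle.\<close>
  have weight: "w I / abs_det lam I = z I / (C * D I)"
    if I: "I \<in> subsets_of_size m DIM('a)" "w I \<noteq> 0" for I
  proof -
    have "D I \<noteq> 0" unfolding D_def by (rule det_transition_mat_nonzero[OF bs basis[OF I]])
    moreover have "card I = DIM('a)" using I(1) by (simp add: subsets_of_size_def)
    ultimately show ?thesis
      using ori_iff[OF basis[OF I]] C by (auto simp: z_def orientation_sign_def D_def abs_if field_simps)
  qed
  have S: "S x = (\<Sum>I\<in>subsets_of_size m DIM('a). z I * (F I x / D I)) / C" for x
  proof -
    have "S x = (\<Sum>I | I \<in> subsets_of_size m DIM('a) \<and> w I \<noteq> 0. z I / (C * D I) * F I x)"
      unfolding S_def by (intro sum.cong refl) (simp add: F_def flip: weight)
    \<comment> \<open>The added terms vanish with \<open>z I\<close>, whatever \<open>D I\<close>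
      is; the cycle condition ranges over all subsets of this size.\<close>
    also have "\<dots> = (\<Sum>I\<in>subsets_of_size m DIM('a). z I / (C * D I) * F I x)"
      using finite_subsets_of_size by (intro sum.mono_neutral_left) (auto simp: z_def)
    finally show ?thesis by (simp add: sum_divide_distrib mult.commute)
  qed
  have exchange: "F I u / D I = F I v / D I + (\<Sum>j\<in>I. (-1) ^ card {i \<in> I. i < j} * H (I - {j}))"
    if I: "I \<in> subsets_of_size m DIM('a)" "w I \<noteq> 0" for I
  proof -
    note fin = subsets_of_sizeD(1)[OF I(1)] and b = basis[OF I]
    have n: "card I = DIM('a)" using I(1) by (simp add: subsets_of_size_def)
    have D: "D I \<noteq> 0" unfolding D_def by (rule det_transition_mat_nonzero[OF bs b])
    define x where "x i = dual_basis_vector lam I i u" for i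
    define y where "y i = dual_basis_vector lam I i v" for i
    define X where "X = (\<Sum>i\<in>I. x i * c i)"
    define Y where "Y = (\<Sum>i\<in>I. y i * c i)"
    have nz: "x i \<noteq> 0" "y i \<noteq> 0" if "i \<in> I" for i
      using generic[OF I that] by (auto simp: x_def y_def)
    have summand: "(X - x j / y j * Y) ^ card I / (x j * (\<Prod>i\<in>I - {j}. x i - x j / y j * y i)) / D I
        = (-1) ^ card {i \<in> I. i < j} * H (I - {j})" if j: "j \<in> I" for j
    proof -
      let ?J = "I - {j}" and ?s = "(-1) ^ card {i \<in> I. i < j} :: real"
      \<comment> \<open>Sign and \<open>D I\<close> cancel in the ratio, leaving the parameter
        \<open>x j / y j\<close> at which the line meets the hyperplane. In the denominator of
        \<open>H\<close>, \<open>E ?J u\<close> supplies \<open>x j\<close>, \<open>D I\<close> and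
        the incidence sign.\<close>
      have E: "E ?J u = ?s * (x j * D I)" "E ?J v = ?s * (y j * D I)"
        unfolding E_def D_def x_def y_def
        by (rule cramer_transition_mat[OF bs fin b j])+
      then have t: "E ?J u / E ?J v = x j / y j" using D by simp
      define a where "a i = x i - x j / y j * y i" for i
      \<comment> \<open>Hence the point \<open>q ?J\<close>, whose coordinates in the basis of
        \<open>I\<close> are the \<open>a i\<close>, lies in the span of the face.\<close>
      have a: "a j = 0" using nz[OF j] by (simp add: a_def)
      have q: "q ?J = (\<Sum>i\<in>I. a i *\<^sub>R lam i)"
      proof -
        have "(\<Sum>i\<in>I. a i *\<^sub>R lam i) = (\<Sum>i\<in>I. x i *\<^sub>R lam i) - (x j / y j) *\<^sub>R (\<Sum>i\<in>I. y i *\<^sub>R lam i)"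
          by (simp add: a_def scaleR_diff_left sum_subtractf scaleR_sum_right)
        then show ?thesis
          by (simp add: q_def t x_def y_def sum_dual_basis_vector[OF b fin])
      qed
      also have "\<dots> = (\<Sum>i\<in>?J. a i *\<^sub>R lam i)"
        using fin j by (simp add: sum.remove a)
      also have "\<dots> \<in> span (lam ` ?J)"
        by (rule span_sum, rule span_scale, rule span_base) (rule imageI)
      finally have span: "q ?J \<in> span (lam ` ?J)" .
      have B: "B ?J i = a i" if i: "i \<in> ?J" for i
      proof -
        have "B ?J i = representation (lam ` I) (q ?J) (lam i)"
          using representation_extend[OF ordered_basis_listedD(2)[OF b fin] span image_mono[OF Diff_subset]]
          by (simp add: B_def)
        also have "\<dots> = dual_basis_vector lam I i (q ?J)"
          using dual_basis_vector_eq_representation[OF b fin] i by simp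
        also have "\<dots> = a i"
          unfolding q using i by (intro dual_basis_vector_sum[OF b fin]) simp
        finally show ?thesis .
      qed
      \<comment> \<open>The numerator is the linear form with coefficients \<open>c\<close>
        evaluated at the intersection point.\<close>
      have "X - x j / y j * Y = (\<Sum>i\<in>I. a i * c i)"
        by (simp add: X_def Y_def a_def left_diff_distrib sum_subtractf sum_distrib_left mult.assoc)
      also have "\<dots> = (\<Sum>i\<in>?J. B ?J i * c i)" using fin j by (simp add: sum.remove a B)
      finally have "H ?J = (X - x j / y j * Y) ^ card I / (E ?J u * (\<Prod>i\<in>?J. a i))"
        using B by (simp add: H_def n)
      then show ?thesis by (simp add: E(1) a_def mult_ac)
    qed
    have "F I u = F I v + (\<Sum>j\<in>I. (X - x j / y j * Y) ^ card I / (x j * (\<Prod>i\<in>I - {j}. x i - x j / y j * y i)))"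
      using power_div_prod_exchange[of I x y X Y] fin nz distinct[OF I]
      by (simp add: F_def n X_def Y_def x_def y_def)
    then have "F I u / D I = F I v / D I +
        (\<Sum>j\<in>I. (X - x j / y j * Y) ^ card I / (x j * (\<Prod>i\<in>I - {j}. x i - x j / y j * y i)) / D I)"
      by (simp add: add_divide_distrib sum_divide_distrib)
    then show ?thesis by (simp only: summand cong: sum.cong)
  qed
  have "(\<Sum>I\<in>subsets_of_size m DIM('a). z I * (F I u / D I)) =
      (\<Sum>I\<in>subsets_of_size m DIM('a). z I * (F I v / D I) +
         z I * (\<Sum>j\<in>I. (-1) ^ card {i \<in> I. i < j} * H (I - {j})))"
  proof (intro sum.cong refl)
    fix I assume "I \<in> subsets_of_size m DIM('a)"
    then show "z I * (F I u / D I) = z I * (F I v / D I) +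
         z I * (\<Sum>j\<in>I. (-1) ^ card {i \<in> I. i < j} * H (I - {j}))"
      using exchange[of I] by (cases "w I = 0") (simp_all add: z_def distrib_left)
  qed
  then show ?thesis
    by (simp add: S sum.distrib cycle_sum_faces_eq_0[OF cycle])
qed

section \<open>The integral of a power of a linear form\<close>

text \<open>\<open>multifan_value_eq\<close> compares the values at \<open>u\<close> and
  \<open>v\<close> for \<open>u\<close> off the zero sets of \<open>R\<close> and of the
  denominators. None of these is the zero function, so \<open>sum_Fract_eq_const\<close> gives
  equality of rational functions.\<close>

lemma multifan_sum_linear_form_power:
  fixes lam :: "nat \<Rightarrow> 'a::euclidean_space" and v :: 'a
  assumes ori: "ori \<in> orientations" and fan: "complete_simplicial_multifan ori m w lam"
    and generic: "\<And>I i. I \<in> subsets_of_size m DIM('a) \<Longrightarrow> w I \<noteq> 0 \<Longrightarrow> i \<in> I \<Longrightarrow>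
        dual_basis_vector lam I i v \<noteq> 0"
  shows "multifan_sum m w lam ((\<Sum>i=1..m. poly_const (c i) * poly_var i) ^ DIM('a)) =
    Fract (const_polyfun (\<Sum>I | I \<in> subsets_of_size m DIM('a) \<and> w I \<noteq> 0.
      w I / (abs_det lam I * (\<Prod>i\<in>I. dual_basis_vector lam I i v)) *
      (\<Sum>i\<in>I. dual_basis_vector lam I i v * c i) ^ DIM('a))) 1"
proof -
  let ?A = "{I. I \<in> subsets_of_size m DIM('a) \<and> w I \<noteq> 0}"
  let ?P = "\<lambda>I i. Polyfun (dual_basis_vector lam I i)"
  let ?y = "\<lambda>I i. const_polyfun (dual_basis_vector lam I i v)"
  \<comment> \<open>That \<open>R\<close> does not vanish at \<open>u\<close> is the condition
    \<open>distinct\<close> of \<open>multifan_value_eq\<close>, for all simplices at once.\<close>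
  define R where "R = (\<Prod>I\<in>?A. \<Prod>i\<in>I. \<Prod>j\<in>I - {i}. ?P I i * ?y I j - ?P I j * ?y I i)"
  have b: "ordered_basis (listed lam I)" "finite I" "I \<subseteq> {1..m}" if "I \<in> ?A" for I
    using that fan subsets_of_sizeD[of I m "DIM('a)"] by (simp_all add: complete_simplicial_multifan_def)
  have app: "apply_polyfun (?P I i) x = dual_basis_vector lam I i x" if "I \<in> ?A" "i \<in> I" for I i x
    using apply_Polyfun_dual_basis_vector[OF b(1,2)] that by blast
  have val: "apply_polyfun (const_polyfun (abs_det lam I) * (\<Prod>i\<in>I. iota lam I (poly_var i))) x =
      abs_det lam I * (\<Prod>i\<in>I. dual_basis_vector lam I i x)" if I: "I \<in> ?A" for I x
    using app[OF I] iota_var[OF b(1,2)[OF I]] by (simp add: apply_polyfun_prod)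
  show ?thesis
    unfolding multifan_sum_def
  proof (rule sum_Fract_eq_const[where R = R])
    show fin_A: "finite ?A" using finite_subsets_of_size by simp
    show "const_polyfun (abs_det lam I) * (\<Prod>i\<in>I. iota lam I (poly_var i)) \<noteq> 0" if I: "I \<in> ?A" for I
    proof
      \<comment> \<open>Evaluation at \<open>v\<close>, where all dual coordinates are nonzero,
        shows that the denominator is not the zero function.\<close>
      assume "const_polyfun (abs_det lam I) * (\<Prod>i\<in>I. iota lam I (poly_var i)) = 0"
      then have "abs_det lam I * (\<Prod>i\<in>I. dual_basis_vector lam I i v) = 0"
        unfolding val[OF I, symmetric] by (simp only: apply_polyfun_simps(1))
      then show False
        using I abs_det_nonzero[OF b(1)[OF I]] generic[of I] b(2)[OF I] by auto
    qed
    \<comment> \<open>At \<open>lam i\<close> this function takes the value of the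
      \<open>j\<close>-th dual coordinate of \<open>v\<close>.\<close>
    have "?P I i * ?y I j - ?P I j * ?y I i \<noteq> 0" if I: "I \<in> ?A" and ij: "i \<in> I" "j \<in> I" "i \<noteq> j" for I i j
    proof
      assume "?P I i * ?y I j - ?P I j * ?y I i = 0"
      then have "apply_polyfun (?P I i * ?y I j - ?P I j * ?y I i) (lam i) = 0" by simp
      then have "dual_basis_vector lam I j v = 0"
        using ij app[OF I] dual_basis_vector(2)[OF b(1,2)[OF I]] by simp
      with generic I ij show False by blast
    qed
    then show "R \<noteq> 0"
      unfolding R_def using fin_A b(2) by (simp add: prod_zero_iff del: mem_Collect_eq)
    fix u
    assume Ru: "apply_polyfun R u \<noteq> 0"
      and bu: "\<forall>I\<in>?A. apply_polyfun (const_polyfun (abs_det lam I) * (\<Prod>i\<in>I. iota lam I (poly_var i))) u \<noteq> 0"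
    have "(\<Sum>I\<in>?A. apply_polyfun (const_polyfun (w I) *
          iota lam I ((\<Sum>i = 1..m. poly_const (c i) * poly_var i) ^ DIM('a))) u /
        apply_polyfun (const_polyfun (abs_det lam I) * (\<Prod>i\<in>I. iota lam I (poly_var i))) u) =
      (\<Sum>I\<in>?A. w I / (abs_det lam I * (\<Prod>i\<in>I. dual_basis_vector lam I i u)) *
        (\<Sum>i\<in>I. dual_basis_vector lam I i u * c i) ^ DIM('a))"
    proof (rule sum.cong[OF refl])
      fix I assume I: "I \<in> ?A"
      show "apply_polyfun (const_polyfun (w I) *
          iota lam I ((\<Sum>i = 1..m. poly_const (c i) * poly_var i) ^ DIM('a))) u /
        apply_polyfun (const_polyfun (abs_det lam I) * (\<Prod>i\<in>I. iota lam I (poly_var i))) u =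
        w I / (abs_det lam I * (\<Prod>i\<in>I. dual_basis_vector lam I i u)) *
          (\<Sum>i\<in>I. dual_basis_vector lam I i u * c i) ^ DIM('a)"
        unfolding val[OF I] unfolding apply_polyfun_simps(5,6)
          apply_iota_linear_form_power[OF b(1-3)[OF I] finite_atLeastAtMost] by simp
    qed
    also have "\<dots> = (\<Sum>I\<in>?A. w I / (abs_det lam I * (\<Prod>i\<in>I. dual_basis_vector lam I i v)) *
        (\<Sum>i\<in>I. dual_basis_vector lam I i v * c i) ^ DIM('a))"
    proof (rule multifan_value_eq[OF ori fan])
      fix I i assume I: "I \<in> subsets_of_size m DIM('a)" "w I \<noteq> 0" and i: "i \<in> I"
      then have IA: "I \<in> ?A" by simp
      have "abs_det lam I * (\<Prod>i\<in>I. dual_basis_vector lam I i u) \<noteq> 0"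
        using bu[rule_format, OF IA] unfolding val[OF IA] .
      then have "dual_basis_vector lam I i u \<noteq> 0"
        using i b(2)[OF IA] by (auto simp: prod_zero_iff)
      then show "dual_basis_vector lam I i u \<noteq> 0 \<and> dual_basis_vector lam I i v \<noteq> 0"
        using generic I i by blast
      fix j assume j: "j \<in> I" "i \<noteq> j"
      have "apply_polyfun (?P I i * ?y I j - ?P I j * ?y I i) u \<noteq> 0"
      proof
        assume "apply_polyfun (?P I i * ?y I j - ?P I j * ?y I i) u = 0"
        then have "apply_polyfun R u = 0"
          unfolding R_def apply_polyfun_prod
          using fin_A IA i j b(2)[OF IA]
          by (intro prod_zero[OF fin_A] bexI[OF _ IA] prod_zero bexI[of _ i] bexI[of _ j]) auto
        with Ru show False by contradiction
      qed
      then show "dual_basis_vector lam I i u * dual_basis_vector lam I j v \<noteq>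
        dual_basis_vector lam I j u * dual_basis_vector lam I i v"
        using app[OF IA] i j by simp
    qed
    finally show "(\<Sum>I\<in>?A. apply_polyfun (const_polyfun (w I) *
          iota lam I ((\<Sum>i = 1..m. poly_const (c i) * poly_var i) ^ DIM('a))) u /
        apply_polyfun (const_polyfun (abs_det lam I) * (\<Prod>i\<in>I. iota lam I (poly_var i))) u) = \<dots>" .
  qed
qed

section \<open>Generic vectors and the final formula\<close>

lemma map_filter_in_subseqs: "map f (filter P xs) \<in> set (subseqs (map f xs))"
  by (induction xs) (auto simp: Let_def)

lemma listed_Diff_in_subseqs:
  assumes "finite I"
  shows "listed lam (I - {j}) \<in> set (subseqs (listed lam I))"
  using map_filter_in_subseqs[of lam "(\<noteq>) j" "sorted_list_of_set I"] assms
  by (simp add: listed_def sorted_list_of_set_remove distinct_remove1_removeAll removeAll_filter_not_eq)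

text \<open>Were the coordinate zero, \<open>v\<close> would lie in the span of the other
  \<open>n - 1\<close> vectors of the simplex, against the independence of the \<open>n\<close>
  vectors they form with \<open>v\<close>.\<close>

lemma generic_vector_dual_basis_vector:
  fixes lam :: "nat \<Rightarrow> 'a::euclidean_space"
  assumes generic: "generic_vector m w lam v"
    and I: "I \<in> subsets_of_size m DIM('a)" "w I \<noteq> 0" "ordered_basis (listed lam I)" and j: "j \<in> I"
  shows "dual_basis_vector lam I j v \<noteq> 0"
proof
  assume zero: "dual_basis_vector lam I j v = 0"
  have fin: "finite I" using subsets_of_sizeD(1)[OF I(1)] .
  let ?vs = "v # listed lam (I - {j})"
  have "?vs \<in> set (subseqs (v # listed lam I))"
    using listed_Diff_in_subseqs[OF fin] by (auto simp: Let_def)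
  moreover have "length ?vs = DIM('a)"
    using I(1) j fin by (auto simp: subsets_of_size_def card_Diff_singleton)
  ultimately have "lin_indep_family ?vs" using generic I by (auto simp: generic_vector_def)
  then have "independent (insert v (lam ` (I - {j})))" "v \<notin> lam ` (I - {j})"
    using fin by (auto simp: lin_indep_family_def set_listed)
  then have "v \<notin> span (lam ` (I - {j}))" by (simp add: independent_insert)
  moreover have "v = (\<Sum>i\<in>I - {j}. dual_basis_vector lam I i v *\<^sub>R lam i)"
    using sum_dual_basis_vector[OF I(3) fin, of v] fin j zero by (simp add: sum.remove)
  then have "v \<in> span (lam ` (I - {j}))"
    by (metis (no_types, lifting) imageI span_base span_scale span_sum)
  ultimately show False by contradiction
qed

theorem theorem6p3:
  fixes ori :: "'a::euclidean_space list set"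
    and m :: nat
    and w :: "nat set \<Rightarrow> real"
    and lam :: "nat \<Rightarrow> 'a"
    and v :: 'a
    and alpha :: "nat set \<Rightarrow> nat \<Rightarrow> real"
    and c :: "nat \<Rightarrow> real"
  assumes "ori \<in> orientations"
    and "complete_simplicial_multifan ori m w lam"
    and "generic_vector m w lam v"
    and "\<And>I. I \<in> multifan_complex m w lam \<Longrightarrow> card I = DIM('a) \<Longrightarrow>
           v = (\<Sum>i\<in>I. alpha I i *\<^sub>R lam i)"
  shows "volume_polynomial m w lam c =
    1 / fact DIM('a) *
    (\<Sum>I | I \<in> multifan_complex m w lam \<and> card I = DIM('a).
       w I / (abs_det lam I * (\<Prod>i\<in>I. alpha I i)) * (\<Sum>i\<in>I. alpha I i * c i) ^ DIM('a))"
proof -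
  let ?A = "{I. I \<in> subsets_of_size m DIM('a) \<and> w I \<noteq> 0}"
  have basis: "ordered_basis (listed lam I)" if "I \<in> subsets_of_size m DIM('a)" "w I \<noteq> 0" for I
    using that assms(2) by (simp add: complete_simplicial_multifan_def)
  \<comment> \<open>A face with \<open>DIM('a)\<close> elements fills the simplex containing
    it.\<close>
  have facets: "{I. I \<in> multifan_complex m w lam \<and> card I = DIM('a)} = ?A"
  proof (intro Set.set_eqI iffI)
    fix J assume "J \<in> {I. I \<in> multifan_complex m w lam \<and> card I = DIM('a)}"
    then obtain I where "I \<in> ?A" "J \<subseteq> I" "card J = DIM('a)" by (auto simp: multifan_complex_def)
    then show "J \<in> ?A"
      using card_subset_eq[of I J] subsets_of_sizeD(1)[of I] by (auto simp: subsets_of_size_def)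
  qed (auto simp: multifan_complex_def subsets_of_size_def)
  have alpha: "dual_basis_vector lam I i v = alpha I i" if I: "I \<in> ?A" and i: "i \<in> I" for I i
  proof -
    have "I \<in> multifan_complex m w lam" "card I = DIM('a)" using facets I by blast+
    from assms(4)[OF this] have "dual_basis_vector lam I i v =
        dual_basis_vector lam I i (\<Sum>i\<in>I. alpha I i *\<^sub>R lam i)" by simp
    then show ?thesis
      using dual_basis_vector_sum[OF basis, of I i "alpha I"] subsets_of_sizeD(1)[of I] I i by simp
  qed
  \<comment> \<open>The sum is a constant fraction, and distinct reals give distinct constant
    fractions, so the definite description picks this value.\<close>
  have "multifan_integral m w lam ((\<Sum>i=1..m. poly_const (c i) * poly_var i) ^ DIM('a)) =
      (\<Sum>I\<in>?A. w I / (abs_det lam I * (\<Prod>i\<in>I. dual_basis_vector lam I i v)) *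
        (\<Sum>i\<in>I. dual_basis_vector lam I i v * c i) ^ DIM('a))"
    using multifan_sum_linear_form_power[OF assms(1,2), of v c]
      generic_vector_dual_basis_vector[OF assms(3)] basis
    by (simp add: multifan_integral_def Fract_const_polyfun_eq_iff)
  also have "\<dots> = (\<Sum>I\<in>?A. w I / (abs_det lam I * (\<Prod>i\<in>I. alpha I i)) * (\<Sum>i\<in>I. alpha I i * c i) ^ DIM('a))"
    by (intro sum.cong refl) (simp add: alpha del: mem_Collect_eq cong: sum.cong prod.cong)
  finally show ?thesis by (simp add: volume_polynomial_def facets)
qed

end
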